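(* Let $T>0$, let $f\in C^0([0,T];C^2(\mathbb R^3))$ and $g\in C^2(\mathbb R^3)$ be $Q_{\mathcal H}$-periodic in $x$, with $\sup_{t\in[0,T]}\|f(\cdot,t)\|_{C^2(\mathbb R^3)}+\|g\|_{C^2(\mathbb R^3)}<\infty$, and let $u$ be the value function $$u(x,t)=\inf\{J_t(x(\cdot),\alpha):(x(\cdot),\alpha)\in\mathcal A(x,t)\}$$ (see context). Let $x\in\mathbb H^1$, $t\in(0,T)$, and let $x(\cdot)$ be an absolutely continuous function on $[t,T]$ with $x(t)=x$ such that, for almost every $s\in(t,T)$, $u(\cdot,s)$ is $\mathcal H$-differentiable at $x(s)$ and $$x'(s)=-D_{\mathcal H}u(x(s),s)\,B^T(x(s)).$$ Then the control law $\alpha(s)=-D_{\mathcal H}u(x(s),s)$ is optimal for $u(x,t)$.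
   Context: Heisenberg group: $\mathbb H^1$ is $\mathbb R^3$ with the group law $x\oplus y=(x_1+y_1,\,x_2+y_2,\,x_3+y_3-x_2y_1+x_1y_2)$. A function $f$ on $\mathbb H^1$ is $Q_{\mathcal H}$-periodic ($Q_{\mathcal H}=[0,1)^3$) if $f(z\oplus x)=f(x)$ for all $z\in\mathbb Z^3$, $x\in\mathbb H^1$. $C^2(\mathbb R^3)$ has norm $\sup(|f|+|Df|+|D^2f|)$ (Euclidean derivatives). $B(x)$ is the $3\times2$ matrix with columns $(1,0,-x_2)^T$ and $(0,1,x_1)^T$; for a row vector $q\in\mathbb R^2$, $qB^T(x)=(q_1,q_2,-x_2q_1+x_1q_2)$. $\mathcal A(x,t)$ is the set of pairs $(x(\cdot),\alpha)\in AC([t,T];\mathbb R^3)\times L^2([t,T];\mathbb R^2)$ with $x(t)=x$ and, for a.e. $s$, $x_1'=\alpha_1$, $x_2'=\alpha_2$, $x_3'=-x_2\alpha_1+x_1\alpha_2$. The cost is $J_t(x(\cdot),\alpha)=\int_t^T\big[\frac12|\alpha(s)|^2+f(x(s),s)\big]ds+g(x(T))$. A control $\alpha$ is optimal for $u(x,t)$ if the associated trajectory $x(\cdot)$ with $(x(\cdot),\alpha)\in\mathcal A(x,t)$ satisfies $J_t(x(\cdot),\alpha)=u(x,t)$. $\mathcal H$-differentiability: $w:\mathbb R^3\to\mathbb R$ is $\mathcal H$-differentiable at $x$ if there is $p\in\mathbb R^2$ such that $\lim_{\mathbb R^2\ni h\to0}\frac{w(x_1+h_1,\,x_2+h_2,\,x_3-x_2h_1+x_1h_2)-w(x)-p\cdot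 h}{|h|}=0$; then $D_{\mathcal H}w(x):=p$. $D_{\mathcal H}u(\cdot,s)$ is taken with respect to the space variable. *)

theory Defs
  imports "HOL-Analysis.Analysis"
begin

section \<open>The Heisenberg group\<close>

definition heis_add :: "real^3 \<Rightarrow> real^3 \<Rightarrow> real^3" (infixl "\<oplus>\<^sub>H" 65) where
  "x \<oplus>\<^sub>H y = vector [x$1 + y$1, x$2 + y$2, x$3 + y$3 - x$2 * y$1 + x$1 * y$2]"

text \<open>Translations act from the left, by integer points.\<close>

definition heis_periodic :: "(real^3 \<Rightarrow> real) \<Rightarrow> bool" where
  "heis_periodic \<phi> \<longleftrightarrow> (\<forall>z x. (\<forall>i. z$i \<in> \<int>) \<longrightarrow> \<phi> (z \<oplus>\<^sub>H x) = \<phi> x)"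

definition Bmat :: "real^3 \<Rightarrow> real^2^3" where
  "Bmat x = vector [vector [1, 0], vector [0, 1], vector [- x$2, x$1]]"

lemma row_times_transpose_Bmat:
  "q v* transpose (Bmat x) = vector [q$1, q$2, - x$2 * q$1 + x$1 * q$2]"
  by (simp add: vec_eq_iff forall_3 Bmat_def matrix_vector_mult_def sum_2)

text \<open>\<open>has_H_derivative w p x\<close>: the limit over horizontal increments \<open>h \<rightarrow> 0\<close> in the plane.\<close>

definition has_H_derivative :: "(real^3 \<Rightarrow> real) \<Rightarrow> real^2 \<Rightarrow> real^3 \<Rightarrow> bool" where
  "has_H_derivative w p x \<longleftrightarrow>
     ((\<lambda>h::real^2.
         (w (vector [x$1 + h$1, x$2 + h$2, x$3 - x$2 * h$1 + x$1 * h$2]) - w x - p \<bullet> h) / norm h)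
       \<longlongrightarrow> 0) (at 0)"

definition H_differentiable :: "(real^3 \<Rightarrow> real) \<Rightarrow> real^3 \<Rightarrow> bool" where
  "H_differentiable w x \<longleftrightarrow> (\<exists>p. has_H_derivative w p x)"

text \<open>Unspecified at points where \<open>w\<close> is not \<open>\<H>\<close>-differentiable.\<close>

definition D_H :: "(real^3 \<Rightarrow> real) \<Rightarrow> real^3 \<Rightarrow> real^2" where
  "D_H w x = (THE p. has_H_derivative w p x)"

section \<open>The space of twice continuously differentiable functions\<close>

definition grad :: "(real^3 \<Rightarrow> real) \<Rightarrow> real^3 \<Rightarrow> real^3" where
  "grad \<phi> x = (\<chi> i. frechet_derivative \<phi> (at x) (axis i 1))"

definition hess :: "(real^3 \<Rightarrow> real) \<Rightarrow> real^3 \<Rightarrow> real^3^3" where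
  "hess \<phi> x = jacobian (grad \<phi>) (at x)"

definition C2_fun :: "(real^3 \<Rightarrow> real) \<Rightarrow> bool" where
  "C2_fun \<phi> \<longleftrightarrow> (\<forall>x. \<phi> differentiable (at x)) \<and> (\<forall>x. grad \<phi> differentiable (at x))
     \<and> continuous_on UNIV (hess \<phi>)"

text \<open>The norm takes values in \<open>[0,\<infinity>]\<close>, so that its finiteness is a meaningful condition.
  All three norms are Euclidean (for the Hessian this is the Frobenius norm).\<close>

definition C2_norm :: "(real^3 \<Rightarrow> real) \<Rightarrow> ennreal" where
  "C2_norm \<phi> = (SUP x. ennreal (\<bar>\<phi> x\<bar> + norm (grad \<phi> x) + norm (hess \<phi> x)))"

text \<open>\<open>f \<in> C\<^sup>0([0,T]; C\<^sup>2)\<close>, for \<open>f\<close> written as a function of \<open>(x,t)\<close>.\<close>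

definition C0_C2 :: "real \<Rightarrow> (real^3 \<Rightarrow> real \<Rightarrow> real) \<Rightarrow> bool" where
  "C0_C2 T f \<longleftrightarrow>
     (\<forall>t\<in>{0..T}. C2_fun (\<lambda>x. f x t)) \<and>
     (\<forall>t\<in>{0..T}. ((\<lambda>s. C2_norm (\<lambda>x. f x s - f x t)) \<longlongrightarrow> 0) (at t within {0..T}))"

section \<open>The control problem\<close>

text \<open>The usual \<open>\<epsilon>\<close>-\<open>\<delta>\<close> definition; \<open>D\<close> ranges over the finite families of non-overlapping
  closed subintervals of \<open>[a,b]\<close>.\<close>

definition abs_continuous_on :: "real \<Rightarrow> real \<Rightarrow> (real \<Rightarrow> real^3) \<Rightarrow> bool" where
  "abs_continuous_on a b \<xi> \<longleftrightarrow>
     (\<forall>\<epsilon>>0. \<exists>\<delta>>0. \<forall>D. D division_of \<Union>D \<and> \<Union>D \<subseteq> {a..b} \<and> (\<Sum>K\<in>D. Sup K - Inf K) < \<delta>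
        \<longrightarrow> (\<Sum>K\<in>D. norm (\<xi> (Sup K) - \<xi> (Inf K))) < \<epsilon>)"

definition square_integrable_on :: "real \<Rightarrow> real \<Rightarrow> (real \<Rightarrow> real^2) \<Rightarrow> bool" where
  "square_integrable_on a b \<alpha> \<longleftrightarrow>
     \<alpha> \<in> borel_measurable (lebesgue_on {a..b}) \<and>
     integrable (lebesgue_on {a..b}) (\<lambda>s. (norm (\<alpha> s))\<^sup>2)"

definition admissible ::
    "real \<Rightarrow> real^3 \<Rightarrow> real \<Rightarrow> ((real \<Rightarrow> real^3) \<times> (real \<Rightarrow> real^2)) set" where
  "admissible T x t =
     {(\<xi>, \<alpha>). abs_continuous_on t T \<xi> \<and> square_integrable_on t T \<alpha> \<and> \<xi> t = x \<and>
        (AE s in lebesgue_on {t..T}.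
           (\<xi> has_vector_derivative
              vector [\<alpha> s$1, \<alpha> s$2, - \<xi> s$2 * \<alpha> s$1 + \<xi> s$1 * \<alpha> s$2]) (at s within {t..T}))}"

definition cost ::
    "real \<Rightarrow> (real^3 \<Rightarrow> real \<Rightarrow> real) \<Rightarrow> (real^3 \<Rightarrow> real) \<Rightarrow> real
      \<Rightarrow> (real \<Rightarrow> real^3) \<Rightarrow> (real \<Rightarrow> real^2) \<Rightarrow> real" where
  "cost T f g t \<xi> \<alpha> =
     (LINT s|lebesgue_on {t..T}. 1/2 * (norm (\<alpha> s))\<^sup>2 + f (\<xi> s) s) + g (\<xi> T)"

text \<open>A real infimum: for bounded continuous data and \<open>t \<in> [0,T]\<close> the set of costs is nonempty
  and bounded below.\<close>

definition value_function ::
    "real \<Rightarrow> (real^3 \<Rightarrow> real \<Rightarrow> real) \<Rightarrow> (real^3 \<Rightarrow> real) \<Rightarrow> real^3 \<Rightarrow> real \<Rightarrow> real" where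
  "value_function T f g x t = (INF (\<xi>, \<alpha>)\<in>admissible T x t. cost T f g t \<xi> \<alpha>)"

text \<open>The control \<open>\<alpha>\<close> and the initial condition determine the trajectory \<open>\<xi>\<close> on \<open>[t,T]\<close>, so
  the existential quantifier picks out the trajectory associated with \<open>\<alpha>\<close>.\<close>

definition optimal_control ::
    "real \<Rightarrow> (real^3 \<Rightarrow> real \<Rightarrow> real) \<Rightarrow> (real^3 \<Rightarrow> real) \<Rightarrow> real^3 \<Rightarrow> real
      \<Rightarrow> (real \<Rightarrow> real^2) \<Rightarrow> bool" where
  "optimal_control T f g x t \<alpha> \<longleftrightarrow>
     (\<exists>\<xi>. (\<xi>, \<alpha>) \<in> admissible T x t \<and> cost T f g t \<xi> \<alpha> = value_function T f g x t)"

end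

theory Submission
  imports Defs
begin

text \<open>
  Along the given curve \<open>\<xi>\<close>, the function \<open>\<phi>(s) = u(\<xi>(s),s)\<close> decreases at least at the rate of the
  running cost. Let \<open>p = D\<^sub>H u(\<xi>(s),s)\<close>, let \<open>r < s\<close> and \<open>h = s - r\<close>, and follow a nearly optimal
  trajectory from \<open>\<xi>(r)\<close> up to time \<open>s\<close>. If its control has energy \<open>N\<close> on \<open>[r,s]\<close>, its end point
  differs from \<open>\<xi>(r)\<close> by a horizontal displacement \<open>\<Delta>\<close> with \<open>|\<Delta>|\<^sup>2 \<le> hN\<close>, up to an error of
  size \<open>hN\<close> in the third coordinate. As \<open>\<xi>(r) - \<xi>(s)\<close> is \<open>hp\<close> horizontally, up to \<open>o(h)\<close>, the
  \<open>\<H>\<close>-differentiability of \<open>u(\<cdot>,s)\<close> at \<open>\<xi>(s)\<close> and the Lipschitz continuity of \<open>u(\<cdot>,s)\<close> give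
  \<open>\<phi>(r) - \<phi>(s) \<ge> N/2 + h f + p \<bullet> (hp + \<Delta>) - o(h)\<close>, which by Young's inequality is at least
  \<open>h (|p|\<^sup>2/2 + f) - o(h)\<close>. Since \<open>\<phi>\<close> is absolutely continuous from above, a Vitali covering argument
  integrates this one-sided estimate, and \<open>u(\<xi>(t),t)\<close> is at least the cost of \<open>\<xi>\<close>.
\<close>

section \<open>Integrating a one-sided derivative bound\<close>

lemma division_real_memE:
  fixes K :: "real set"
  assumes "D division_of S" "K \<in> D"
  obtains c d where "K = {c..d}" "c \<le> d" "Inf K = c" "Sup K = d"
proof -
  obtain c d where "K = cbox c d" "K \<noteq> {}"
    using division_ofD(3,4)[OF assms] by blast
  then have "K = {c..d}" "c \<le> d" by auto
  then show ?thesis using that by simp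
qed

text \<open>Tagging each interval by its right end point gives a tagged division, over which
  increments telescope. The tag is a function of the interval, so sums over pairs reindex to sums
  over intervals.\<close>

lemma sum_division_telescope:
  fixes \<phi> :: "real \<Rightarrow> 'a::real_normed_vector"
  assumes "a \<le> b" "q division_of {a..b}"
  shows "(\<Sum>K\<in>q. \<phi> (Sup K) - \<phi> (Inf K)) = \<phi> b - \<phi> a"
proof -
  have "(\<lambda>K. (Sup K, K)) ` q tagged_division_of {a..b}"
  proof (rule tagged_division_ofI)
    show "finite ((\<lambda>K. (Sup K, K)) ` q)" using assms(2) by blast
    show "\<Union> {K. \<exists>x. (x, K) \<in> (\<lambda>K. (Sup K, K)) ` q} = {a..b}"
      using division_ofD(6)[OF assms(2)] by (auto simp: image_iff)
  next
    fix x K assume xK: "(x, K) \<in> (\<lambda>K. (Sup K, K)) ` q"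
    then have K: "K \<in> q" "x = Sup K" by auto
    from division_real_memE[OF assms(2) K(1)]
    obtain c d where "K = {c..d}" "c \<le> d" "Sup K = d" by metis
    then show "x \<in> K" "\<exists>a b. K = cbox a b" using K by auto
    show "K \<subseteq> {a..b}" using K assms(2) by blast
  next
    fix x1 K1 x2 K2
    assume "(x1, K1) \<in> (\<lambda>K. (Sup K, K)) ` q" "(x2, K2) \<in> (\<lambda>K. (Sup K, K)) ` q"
      "(x1, K1) \<noteq> (x2, K2)"
    then show "interior K1 \<inter> interior K2 = {}"
      using division_ofD(5)[OF assms(2)] by auto
  qed
  from additive_tagged_division_1[OF assms(1) this, of \<phi>]
  show ?thesis by (simp add: sum.reindex inj_on_def)
qed

text \<open>Truncation of \<open>\<bar>h x\<bar>\<close> at height \<open>n\<close>: the truncated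
  part contributes at most \<open>n\<close> times the total length, and for large \<open>n\<close>
  the remainder has integral below \<open>\<epsilon>/2\<close> over all of
  \<open>{a..b}\<close>.\<close>

lemma absolutely_integrable_small_divisions:
  fixes h :: "real \<Rightarrow> real"
  assumes h: "h absolutely_integrable_on {a..b}" and "\<epsilon> > 0"
  obtains \<delta> where "\<delta> > 0"
    "\<And>D. D division_of \<Union>D \<Longrightarrow> \<Union>D \<subseteq> {a..b} \<Longrightarrow> (\<Sum>K\<in>D. Sup K - Inf K) < \<delta>
       \<Longrightarrow> (\<Sum>K\<in>D. \<bar>integral K h\<bar>) < \<epsilon>"
proof -
  let ?g = "\<lambda>x. \<bar>h x\<bar>"
  let ?m = "\<lambda>n::nat. \<lambda>x. min \<bar>h x\<bar> (real n)"
  have g: "?g integrable_on {a..b}" "?g absolutely_integrable_on {a..b}"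
    using h absolutely_integrable_on_def absolutely_integrable_abs by fastforce+
  have m: "?m n integrable_on {a..b}" for n
    using absolutely_integrable_min_1[OF g(2), of "\<lambda>_. real n"]
      absolutely_integrable_on_def absolutely_integrable_on_const by blast
  have "(\<lambda>n. integral {a..b} (?m n)) \<longlonglongrightarrow> integral {a..b} ?g"
  proof (rule dominated_convergence(2)[OF m g(1)])
    fix x
    have "eventually (\<lambda>n. ?m n x = \<bar>h x\<bar>) sequentially"
      using eventually_ge_at_top[of "nat \<lceil>\<bar>h x\<bar>\<rceil>"]
      by eventually_elim linarith
    then show "(\<lambda>n. ?m n x) \<longlonglongrightarrow> \<bar>h x\<bar>" by (rule tendsto_eventually)
  qed auto
  then obtain n where n: "\<bar>integral {a..b} (?m n) - integral {a..b} ?g\<bar> < \<epsilon>/2"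
    using \<open>\<epsilon> > 0\<close> unfolding LIMSEQ_iff real_norm_def by (meson half_gt_zero order_refl)
  let ?r = "\<lambda>x. \<bar>h x\<bar> - ?m n x"
  have r: "?r integrable_on {a..b}" by (rule integrable_diff[OF g(1) m])
  show thesis
  proof (rule that)
    \<comment> \<open>The summand 1 keeps the threshold positive when the truncation level
      \<open>n\<close> is 0.\<close>
    show "\<epsilon> / (2 * (real n + 1)) > 0" using \<open>\<epsilon> > 0\<close> by simp
    fix D assume D: "D division_of \<Union>D" "\<Union>D \<subseteq> {a..b}"
      and len: "(\<Sum>K\<in>D. Sup K - Inf K) < \<epsilon> / (2 * (real n + 1))"
    have "\<bar>integral K h\<bar> \<le> integral K ?r + (real n + 1) * (Sup K - Inf K)" if K: "K \<in> D" for K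
    proof -
      obtain c d where cd: "K = {c..d}" "c \<le> d" "Inf K = c" "Sup K = d"
        using division_real_memE[OF D(1) K] by metis
      have sub: "{c..d} \<subseteq> {a..b}" using D(2) K cd(1) by blast
      have i: "h integrable_on {c..d}" "?g integrable_on {c..d}" "?m n integrable_on {c..d}"
        using integrable_on_subinterval[OF _ sub] h g m absolutely_integrable_on_def by blast+
      have "\<bar>integral K h\<bar> \<le> integral K ?g"
        using integral_norm_bound_integral[of h K ?g] i cd(1) by auto
      also have "\<dots> = integral K ?r + integral K (?m n)"
        using integral_diff[of ?g K "?m n"] i cd(1) by simp
      also have "integral K (?m n) \<le> integral K (\<lambda>_. real n)"
        using i cd(1) by (intro integral_le) auto
      also have "\<dots> \<le> (real n + 1) * (Sup K - Inf K)"
        using cd by (simp add: mult_right_mono algebra_simps)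
      finally show ?thesis by simp
    qed
    then have "(\<Sum>K\<in>D. \<bar>integral K h\<bar>) \<le> (\<Sum>K\<in>D. integral K ?r) + (real n + 1) * (\<Sum>K\<in>D. Sup K - Inf K)"
      by (simp add: sum_distrib_left sum_mono flip: sum.distrib)
    also have "(\<Sum>K\<in>D. integral K ?r) = integral (\<Union>D) ?r"
      by (rule integral_combine_division_topdown[OF integrable_on_subdivision[OF D(1) r D(2)] D(1), symmetric])
    also have "\<dots> \<le> integral {a..b} ?r"
      by (intro integral_subset_le D(2) r integrable_on_subdivision[OF D(1) r D(2)]) auto
    also have "\<dots> < \<epsilon>/2" using n integral_diff[OF g(1) m[of n]] by linarith
    also have "(real n + 1) * (\<Sum>K\<in>D. Sup K - Inf K) < \<epsilon>/2"
      using len by (simp add: field_simps)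
    finally show "(\<Sum>K\<in>D. \<bar>integral K h\<bar>) < \<epsilon>" by simp
  qed
qed

text \<open>Only upward increments are controlled: for the value function along a curve, an upper bound
  for increments in time follows from restricting trajectories, while the lower one would require
  concatenating them.\<close>

definition upper_abs_continuous :: "real \<Rightarrow> real \<Rightarrow> (real \<Rightarrow> real) \<Rightarrow> bool" where
  "upper_abs_continuous a b \<phi> \<longleftrightarrow>
     (\<forall>\<epsilon>>0. \<exists>\<delta>>0. \<forall>D. D division_of \<Union>D \<and> \<Union>D \<subseteq> {a..b} \<and> (\<Sum>K\<in>D. Sup K - Inf K) < \<delta>
        \<longrightarrow> (\<Sum>K\<in>D. \<phi> (Sup K) - \<phi> (Inf K)) < \<epsilon>)"

text \<open>The intervals \<open>[s - h, s]\<close> on which the increment of \<open>\<phi>\<close> is controlled, with tags at their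
  right end points, form a Vitali cover. A finite disjoint subfamily fills \<open>[a,b]\<close> up to small measure:
  there Henstock's lemma compares the Riemann sum with the integral, and the remaining gaps contribute
  little by absolute continuity. (Cousin's lemma is not applicable, as the tags are one-sided.)\<close>

lemma upper_abs_continuous_increment_le:
  fixes \<phi> \<gamma> :: "real \<Rightarrow> real"
  assumes "a \<le> b" and ac: "upper_abs_continuous a b \<phi>"
    and \<gamma>: "\<gamma> absolutely_integrable_on {a..b}" and N: "negligible N"
    and dini: "\<And>s e. s \<in> {a<..b} - N \<Longrightarrow> e > 0 \<Longrightarrow>
       \<exists>d>0. \<forall>r\<in>{a..<s}. s - r < d \<longrightarrow> \<phi> s - \<phi> r \<le> (s - r) * (\<gamma> s + e)"
  shows "\<phi> b - \<phi> a \<le> integral {a..b} \<gamma>"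
proof (rule field_le_epsilon)
  fix e0 :: real assume "e0 > 0"
  \<comment> \<open>Three shares are for the growth of \<open>\<phi>\<close> over the gaps, the
    integral of \<open>\<gamma>\<close> over the gaps and the Henstock error; \<open>b - a\<close>
    is for the slack \<open>\<epsilon>\<close> per unit length in \<open>dini\<close>.\<close>
  define \<epsilon> where "\<epsilon> = e0 / (b - a + 3)"
  have \<epsilon>: "\<epsilon> > 0" using \<open>e0 > 0\<close> \<open>a \<le> b\<close> by (simp add: \<epsilon>_def)
  have \<gamma>i: "\<gamma> integrable_on cbox a b" using \<gamma> by (simp add: absolutely_integrable_on_def)
  obtain \<delta>1 where \<delta>1: "\<delta>1 > 0"
    "\<And>D. D division_of \<Union>D \<Longrightarrow> \<Union>D \<subseteq> {a..b} \<Longrightarrow> (\<Sum>K\<in>D. Sup K - Inf K) < \<delta>1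
        \<Longrightarrow> (\<Sum>K\<in>D. \<phi> (Sup K) - \<phi> (Inf K)) < \<epsilon>"
    using ac[unfolded upper_abs_continuous_def, rule_format, OF \<epsilon>] by blast
  obtain \<delta>2 where \<delta>2: "\<delta>2 > 0"
    "\<And>D. D division_of \<Union>D \<Longrightarrow> \<Union>D \<subseteq> {a..b} \<Longrightarrow> (\<Sum>K\<in>D. Sup K - Inf K) < \<delta>2
        \<Longrightarrow> (\<Sum>K\<in>D. \<bar>integral K \<gamma>\<bar>) < \<epsilon>"
    using absolutely_integrable_small_divisions[OF \<gamma> \<epsilon>] by blast
  obtain G where G: "gauge G"
    "\<And>p. \<lbrakk>p tagged_partial_division_of (cbox a b); G fine p\<rbrakk> \<Longrightarrow>
             sum (\<lambda>(x,k). norm(measure lborel k *\<^sub>R \<gamma> x - integral k \<gamma>)) p < \<epsilon>"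
    using Henstock_lemma[OF \<gamma>i \<epsilon>] by blast
  define S where "S = {a<..b} - N"
  \<comment> \<open>An index \<open>(s, h)\<close> stands for the interval from \<open>s - h\<close>
    to \<open>s\<close>, later written as a ball with centre \<open>s - h/2\<close> and radius
    \<open>h/2\<close> to fit the Vitali theorem. Containment in \<open>G s\<close> makes it fine
    for the tag \<open>s\<close>.\<close>
  define I where "I = {(s, h). s \<in> S \<and> 0 < h \<and> a \<le> s - h \<and> {s - h..s} \<subseteq> G s \<and>
      \<phi> s - \<phi> (s - h) \<le> h * (\<gamma> s + \<epsilon>)}"
  have cb: "cball (fst i - snd i / 2) (snd i / 2) = {fst i - snd i..fst i}" for i :: "real \<times> real"
    by (simp add: cball_eq_atLeastAtMost)
  have vit: "\<exists>i. i \<in> I \<and> s \<in> cball (fst i - snd i / 2) (snd i / 2) \<and> snd i / 2 < d"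
    if s: "s \<in> S" and "0 < d" for s d
  proof -
    obtain d1 where d1: "d1 > 0"
      "\<And>r. r \<in> {a..<s} \<Longrightarrow> s - r < d1 \<Longrightarrow> \<phi> s - \<phi> r \<le> (s - r) * (\<gamma> s + \<epsilon>)"
      using dini[OF s[unfolded S_def] \<epsilon>] by blast
    have "open (G s)" "s \<in> G s" using G(1) by (auto simp: gauge_def)
    then obtain d2 where d2: "d2 > 0" "cball s d2 \<subseteq> G s" using open_contains_cball by blast
    have as: "a < s" using s by (simp add: S_def)
    define h where "h = min (min (s - a) d) (min (d1/2) d2)"
    have h: "0 < h" "h \<le> s - a" "h \<le> d" "h < d1" "h \<le> d2"
      using as \<open>0 < d\<close> d1(1) d2(1) by (auto simp: h_def min_def)
    have "{s - h..s} \<subseteq> cball s d2" using h by (auto simp: dist_real_def)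
    then have "(s, h) \<in> I" using s h d1(2)[of "s - h"] d2(2) by (auto simp: I_def)
    then show ?thesis
      using h by (intro exI[of _ "(s, h)"]) (simp only: cb, simp)
  qed
  have rad: "0 < snd i / 2" if "i \<in> I" for i using that by (auto simp: I_def)
  obtain C where C: "countable C" "C \<subseteq> I"
     "pairwise (\<lambda>i j. disjnt (cball (fst i - snd i / 2) (snd i / 2)) (cball (fst j - snd j / 2) (snd j / 2))) C"
     "negligible (S - (\<Union>i\<in>C. cball (fst i - snd i / 2) (snd i / 2)))"
    by (rule Vitali_covering_theorem_cballs[of I "\<lambda>i. snd i / 2" S "\<lambda>i. fst i - snd i / 2", OF rad vit])
  define Ks where "Ks = (\<lambda>i. {fst i - snd i..fst i}) ` C"
  have mem: "\<exists>s h. K = {s - h..s} \<and> (s, h) \<in> I \<and> (s, h) \<in> C" if K: "K \<in> Ks" for K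
  proof -
    obtain i where "i \<in> C" "K = {fst i - snd i..fst i}" using K unfolding Ks_def by blast
    then show ?thesis using C(2) by (metis prod.collapse subsetD)
  qed
  have sub_ab: "K \<subseteq> {a..b}" if "K \<in> Ks" for K
    using mem[OF that] by (auto simp: I_def S_def)
  have disj: "K \<inter> L = {}" if KL: "K \<in> Ks" "L \<in> Ks" "K \<noteq> L" for K L
  proof -
    obtain i j where "i \<in> C" "j \<in> C" "K = {fst i - snd i..fst i}" "L = {fst j - snd j..fst j}"
      using KL unfolding Ks_def by blast
    then show ?thesis
      using C(3) \<open>K \<noteq> L\<close> unfolding pairwise_def cb disjnt_def by metis
  qed
  have Kslm: "K \<in> lmeasurable" if "K \<in> Ks" for K using mem[OF that] by auto
  have neg: "negligible ({a..b} - \<Union>Ks)"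
  proof (rule negligible_subset)
    \<comment> \<open>The point \<open>a\<close> has no interval to its left within
      \<open>{a..b}\<close> and joins the exceptional set.\<close>
    show "negligible ((S - \<Union>Ks) \<union> (N \<union> {a}))"
      using C(4) N unfolding cb Ks_def by (simp add: negligible_Un)
  qed (auto simp: S_def)
  have full: "measure lebesgue (\<Union>Ks) = b - a"
  proof -
    have "measure lebesgue (\<Union>Ks) = measure lebesgue {a..b}"
    proof (rule measure_negligible_symdiff)
      show "negligible ({a..b} - \<Union>Ks \<union> (\<Union>Ks - {a..b}))"
      proof -
        have "\<Union>Ks - {a..b} = {}" using sub_ab by blast
        then show ?thesis using neg by simp
      qed
    qed auto
    then show ?thesis using \<open>a \<le> b\<close> by simp
  qed
  have measle: "measure lebesgue (\<Union>D) \<le> b - a" if "D \<subseteq> Ks" "finite D" for D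
  proof -
    have "measure lebesgue (\<Union>D) \<le> measure lebesgue {a..b}"
      using that sub_ab Kslm by (intro measure_mono_fmeasurable) (auto intro!: fmeasurableD fmeasurable.finite_Union)
    then show ?thesis using \<open>a \<le> b\<close> by simp
  qed
  have cnt: "countable Ks" "min \<delta>1 \<delta>2 > 0"
    using C(1) \<delta>1(1) \<delta>2(1) by (auto simp: Ks_def)
  obtain D where D: "D \<subseteq> Ks" "finite D"
    "measure lebesgue (\<Union>Ks) - min \<delta>1 \<delta>2 < measure lebesgue (\<Union>D)"
    using measure_countable_Union_approachable[OF cnt Kslm measle] by blast
  have Ddiv: "D division_of \<Union>D"
  proof (rule division_ofI)
    fix K assume "K \<in> D"
    then obtain s h where "K = {s - h..s}" "(s, h) \<in> I" using mem D(1) by blast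
    then show "K \<noteq> {}" "\<exists>a b. K = cbox a b" by (auto simp: I_def)
  next
    fix K L assume "K \<in> D" "L \<in> D" "K \<noteq> L"
    then have "K \<inter> L = {}" using disj D(1) by blast
    then show "interior K \<inter> interior L = {}" using interior_subset by blast
  qed (use D in auto)
  have Dsub: "\<Union>D \<subseteq> cbox a b" using D(1) sub_ab by auto
  obtain q where q: "D \<subseteq> q" "q division_of cbox a b"
    using partial_division_extend_interval[OF Ddiv Dsub] .
  have q': "q division_of {a..b}" "finite q" using q(2) by auto
  \<comment> \<open>The gaps left by the finite family \<open>D\<close>. Their total length will be
    below both \<open>\<delta>1\<close> and \<open>\<delta>2\<close>, so absolute continuity applies
    to them for \<open>\<phi>\<close> as well as for the integral of
    \<open>\<gamma>\<close>.\<close>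
  define R where "R = q - D"
  have qsplit: "(\<Sum>K\<in>q. F K) = (\<Sum>K\<in>D. F K) + (\<Sum>K\<in>R. F K)" for F :: "real set \<Rightarrow> real"
    unfolding R_def by (metis q(1) q'(2) sum.subset_diff add.commute)
  have Rdiv: "R division_of \<Union>R" "\<Union>R \<subseteq> {a..b}"
    using division_of_subset[of q R] q' q(2) by (auto simp: R_def)
  have measD: "measure lebesgue (\<Union>D) \<le> (\<Sum>K\<in>D. Sup K - Inf K)"
  proof -
    have "measure lebesgue (\<Union>D) \<le> (\<Sum>K\<in>D. measure lebesgue K)"
      using D Kslm by (intro measure_Union_le) (auto dest: fmeasurableD)
    also have "\<dots> = (\<Sum>K\<in>D. Sup K - Inf K)"
    proof (rule sum.cong)
      fix K assume "K \<in> D"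
      then obtain c d where "K = {c..d}" "c \<le> d" "Inf K = c" "Sup K = d"
        using division_real_memE[OF Ddiv] by metis
      then show "measure lebesgue K = Sup K - Inf K" by simp
    qed simp
    finally show ?thesis .
  qed
  have "(\<Sum>K\<in>q. Sup K - Inf K) = b - a"
    using sum_division_telescope[OF \<open>a \<le> b\<close> q'(1), of "\<lambda>x. x"] by simp
  then have Rlen: "(\<Sum>K\<in>R. Sup K - Inf K) < min \<delta>1 \<delta>2"
    using D(3) measD full qsplit[of "\<lambda>K. Sup K - Inf K"] by linarith
  define p where "p = (\<lambda>K. (Sup K, K)) ` D"
  have Dmem: "\<exists>s h. K = {s - h..s} \<and> (s, h) \<in> I \<and> Sup K = s \<and> Inf K = s - h" if K: "K \<in> D" for K
  proof -
    obtain s h where "K = {s - h..s}" "(s, h) \<in> I" using mem D(1) K by blast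
    moreover then have "Sup K = s" "Inf K = s - h" by (auto simp: I_def)
    ultimately show ?thesis by blast
  qed
  have "p tagged_partial_division_of cbox a b"
    unfolding tagged_partial_division_of_def
  proof (intro conjI allI impI)
    show "finite p" using D(2) by (simp add: p_def)
  next
    fix x K assume "(x, K) \<in> p"
    then have K: "K \<in> D" "x = Sup K" by (auto simp: p_def)
    obtain s h where sh: "K = {s - h..s}" "(s, h) \<in> I" "Sup K = s" using Dmem[OF K(1)] by blast
    show "x \<in> K" using sh K by (auto simp: I_def)
    show "K \<subseteq> cbox a b" using K Dsub by blast
    show "\<exists>a b. K = cbox a b" using sh by auto
  next
    fix x1 K1 x2 K2 assume "(x1, K1) \<in> p \<and> (x2, K2) \<in> p \<and> (x1, K1) \<noteq> (x2, K2)"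
    then show "interior K1 \<inter> interior K2 = {}"
      using division_ofD(5)[OF Ddiv] by (auto simp: p_def)
  qed
  moreover have "G fine p"
    using Dmem by (fastforce simp: fine_def p_def I_def)
  ultimately have "sum (\<lambda>(x,k). norm (measure lborel k *\<^sub>R \<gamma> x - integral k \<gamma>)) p < \<epsilon>" by (rule G(2))
  then have hen: "(\<Sum>K\<in>D. \<bar>measure lborel K * \<gamma> (Sup K) - integral K \<gamma>\<bar>) < \<epsilon>"
    by (simp add: p_def sum.reindex inj_on_def)
  have "\<phi> b - \<phi> a = (\<Sum>K\<in>D. \<phi> (Sup K) - \<phi> (Inf K)) + (\<Sum>K\<in>R. \<phi> (Sup K) - \<phi> (Inf K))"
    using sum_division_telescope[OF \<open>a \<le> b\<close> q'(1), of \<phi>] qsplit by metis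
  also have "(\<Sum>K\<in>R. \<phi> (Sup K) - \<phi> (Inf K)) \<le> \<epsilon>"
    using \<delta>1(2)[OF Rdiv] Rlen by simp
  also have "(\<Sum>K\<in>D. \<phi> (Sup K) - \<phi> (Inf K)) \<le>
      (\<Sum>K\<in>D. \<bar>measure lborel K * \<gamma> (Sup K) - integral K \<gamma>\<bar> + integral K \<gamma> + \<epsilon> * (Sup K - Inf K))"
  proof (rule sum_mono)
    fix K assume "K \<in> D"
    then obtain s h where sh: "K = {s - h..s}" "(s, h) \<in> I" "Sup K = s" "Inf K = s - h" using Dmem by blast
    then have "\<phi> (Sup K) - \<phi> (Inf K) \<le> measure lborel K * \<gamma> (Sup K) + \<epsilon> * (Sup K - Inf K)"
      by (auto simp: I_def algebra_simps)
    then show "\<phi> (Sup K) - \<phi> (Inf K) \<le>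
      \<bar>measure lborel K * \<gamma> (Sup K) - integral K \<gamma>\<bar> + integral K \<gamma> + \<epsilon> * (Sup K - Inf K)" by linarith
  qed
  also have "\<dots> = (\<Sum>K\<in>D. \<bar>measure lborel K * \<gamma> (Sup K) - integral K \<gamma>\<bar>) + (\<Sum>K\<in>D. integral K \<gamma>)
       + \<epsilon> * (\<Sum>K\<in>D. Sup K - Inf K)"
    by (simp add: sum.distrib sum_distrib_left)
  also have "(\<Sum>K\<in>D. Sup K - Inf K) \<le> b - a"
  proof -
    have "0 \<le> (\<Sum>K\<in>R. Sup K - Inf K)"
    proof (rule sum_nonneg)
      fix K assume "K \<in> R"
      then show "0 \<le> Sup K - Inf K" by (rule division_real_memE[OF Rdiv(1)]) simp
    qed
    then show ?thesis using \<open>(\<Sum>K\<in>q. Sup K - Inf K) = b - a\<close> qsplit[of "\<lambda>K. Sup K - Inf K"] by simp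
  qed
  also have "(\<Sum>K\<in>D. integral K \<gamma>) \<le> integral {a..b} \<gamma> + \<epsilon>"
  proof -
    have "integral {a..b} \<gamma> = (\<Sum>K\<in>q. integral K \<gamma>)"
      using integral_combine_division_topdown[OF \<gamma>i q(2)] by simp
    moreover have "\<bar>\<Sum>K\<in>R. integral K \<gamma>\<bar> \<le> (\<Sum>K\<in>R. \<bar>integral K \<gamma>\<bar>)" by (rule sum_abs)
    moreover have "(\<Sum>K\<in>R. \<bar>integral K \<gamma>\<bar>) < \<epsilon>" using \<delta>2(2)[OF Rdiv] Rlen by simp
    ultimately show ?thesis using qsplit[of "\<lambda>K. integral K \<gamma>"] by linarith
  qed
  finally have "\<phi> b - \<phi> a \<le> integral {a..b} \<gamma> + \<epsilon> * (b - a + 3)"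
    using hen \<epsilon> by (simp add: algebra_simps)
  moreover have "\<epsilon> * (b - a + 3) = e0" using \<open>a \<le> b\<close> by (simp add: \<epsilon>_def)
  ultimately show "\<phi> b - \<phi> a \<le> integral {a..b} \<gamma> + e0" by simp
qed

section \<open>Integrability, null sets and derivatives almost everywhere\<close>

lemma integrable_lebesgue_on_iff:
  fixes f :: "'a::euclidean_space \<Rightarrow> 'b::euclidean_space"
  assumes "S \<in> sets lebesgue"
  shows "integrable (lebesgue_on S) f \<longleftrightarrow> f absolutely_integrable_on S"
  using assms by (simp add: integrable_restrict_space set_integrable_def)

lemma AE_lebesgue_on_negligibleE:
  assumes "AE s in lebesgue_on S. P s" "S \<in> sets lebesgue"
  obtains N where "negligible N" "\<And>s. s \<in> S - N \<Longrightarrow> P s"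
proof -
  have "AE s in lebesgue. s \<in> S \<longrightarrow> P s"
    using assms by (simp add: AE_restrict_space_iff)
  then obtain N where "\<And>s. s \<in> space lebesgue - N \<Longrightarrow> s \<in> S \<longrightarrow> P s" "N \<in> null_sets lebesgue"
    using AE_E3 by blast
  then show ?thesis using that[of N] by (auto simp: negligible_iff_null_sets)
qed

lemma AE_lebesgue_on_negligibleI:
  assumes "negligible N" "\<And>s. s \<in> S - N \<Longrightarrow> P s" "S \<in> sets lebesgue"
  shows "AE s in lebesgue_on S. P s"
proof -
  have "AE s in lebesgue. s \<in> S \<longrightarrow> P s"
    using assms(1,2) by (intro AE_I'[of N]) (auto simp: negligible_iff_null_sets)
  then show ?thesis using assms(3) by (simp add: AE_restrict_space_iff)
qed

lemma has_vector_derivative_withinD: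
  fixes \<xi> :: "real \<Rightarrow> 'a::real_normed_vector"
  assumes "(\<xi> has_vector_derivative v) (at s within S)" "e > 0"
  obtains d where "d > 0"
    "\<And>r. r \<in> S \<Longrightarrow> \<bar>r - s\<bar> < d \<Longrightarrow> norm (\<xi> r - \<xi> s - (r - s) *\<^sub>R v) \<le> e * \<bar>r - s\<bar>"
  using assms unfolding has_vector_derivative_def has_derivative_within_alt real_norm_def by blast

text \<open>A two-sided derivative supplies the one-sided bound of the covering argument. In this
  form the argument integrates the velocities of admissible trajectories.\<close>

lemma upper_abs_continuous_derivative_le:
  fixes \<phi> k :: "real \<Rightarrow> real"
  assumes "a \<le> b" "upper_abs_continuous a b \<phi>" "k absolutely_integrable_on {a..b}"
    and der: "AE s in lebesgue_on {a..b}.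
      \<exists>d\<le>k s. (\<phi> has_vector_derivative d) (at s within {a..b})"
  shows "\<phi> b - \<phi> a \<le> integral {a..b} k"
proof -
  obtain N where N: "negligible N"
    "\<And>s. s \<in> {a..b} - N \<Longrightarrow> \<exists>d\<le>k s. (\<phi> has_vector_derivative d) (at s within {a..b})"
    using AE_lebesgue_on_negligibleE[OF der] by auto
  show ?thesis
  proof (rule upper_abs_continuous_increment_le[OF assms(1-3) N(1)])
    fix s e :: real assume s: "s \<in> {a<..b} - N" and "e > 0"
    then obtain d where d: "d \<le> k s" "(\<phi> has_vector_derivative d) (at s within {a..b})"
      using N(2)[of s] by auto
    obtain \<delta> where \<delta>: "\<delta> > 0" "\<And>r. r \<in> {a..b} \<Longrightarrow> \<bar>r - s\<bar> < \<delta> \<Longrightarrow>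
        norm (\<phi> r - \<phi> s - (r - s) *\<^sub>R d) \<le> e * \<bar>r - s\<bar>"
      using has_vector_derivative_withinD[OF d(2) \<open>e > 0\<close>] by blast
    have "\<phi> s - \<phi> r \<le> (s - r) * (k s + e)" if r: "r \<in> {a..<s}" "s - r < \<delta>" for r
    proof -
      have "\<bar>\<phi> r - \<phi> s - (r - s) * d\<bar> \<le> e * (s - r)" using \<delta>(2)[of r] r s by auto
      moreover have "(s - r) * d \<le> (s - r) * k s" using d(1) r by (intro mult_left_mono) auto
      ultimately show ?thesis by (simp add: algebra_simps abs_le_iff)
    qed
    then show "\<exists>d>0. \<forall>r\<in>{a..<s}. s - r < d \<longrightarrow> \<phi> s - \<phi> r \<le> (s - r) * (k s + e)"
      using \<delta>(1) by blast
  qed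
qed

section \<open>Absolutely continuous curves\<close>

lemma abs_continuous_on_subinterval:
  assumes "abs_continuous_on a b \<xi>" "a \<le> c" "d \<le> b"
  shows "abs_continuous_on c d \<xi>"
  unfolding abs_continuous_on_def
proof (intro allI impI)
  fix e :: real assume "e > 0"
  with assms(1) obtain \<delta> where \<delta>: "\<delta> > 0" "\<And>D. D division_of \<Union>D \<and> \<Union>D \<subseteq> {a..b} \<and>
     (\<Sum>K\<in>D. Sup K - Inf K) < \<delta> \<Longrightarrow> (\<Sum>K\<in>D. norm (\<xi> (Sup K) - \<xi> (Inf K))) < e"
    unfolding abs_continuous_on_def by blast
  have "{c..d} \<subseteq> {a..b}" using assms by auto
  then show "\<exists>\<delta>>0. \<forall>D. D division_of \<Union> D \<and> \<Union> D \<subseteq> {c..d} \<and> (\<Sum>K\<in>D. Sup K - Inf K) < \<delta> \<longrightarrow>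
             (\<Sum>K\<in>D. norm (\<xi> (Sup K) - \<xi> (Inf K))) < e"
    using \<delta> by (meson subset_trans)
qed

lemma abs_continuous_on_imp_continuous_on:
  assumes ac: "abs_continuous_on a b \<xi>"
  shows "continuous_on {a..b} \<xi>"
  unfolding continuous_on_iff
proof (intro ballI allI impI)
  fix s e :: real assume s: "s \<in> {a..b}" and "e > 0"
  then obtain \<delta> where \<delta>: "\<delta> > 0" "\<And>D. D division_of \<Union>D \<and> \<Union>D \<subseteq> {a..b} \<and>
     (\<Sum>K\<in>D. Sup K - Inf K) < \<delta> \<Longrightarrow> (\<Sum>K\<in>D. norm (\<xi> (Sup K) - \<xi> (Inf K))) < e"
    using ac unfolding abs_continuous_on_def by blast
  have *: "dist (\<xi> d) (\<xi> c) < e" if "c \<in> {a..b}" "d \<in> {a..b}" "c \<le> d" "d - c < \<delta>" for c d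
  proof -
    have "{{c..d}} division_of \<Union>{{c..d}}" using that by (auto simp: division_of_def)
    then show ?thesis using \<delta>(2)[of "{{c..d}}"] that by (auto simp: dist_norm)
  qed
  have "dist (\<xi> r) (\<xi> s) < e" if "r \<in> {a..b}" "dist r s < \<delta>" for r
    using *[of r s] *[of s r] that s by (cases "r \<le> s") (auto simp: dist_real_def dist_commute)
  then show "\<exists>d>0. \<forall>r\<in>{a..b}. dist r s < d \<longrightarrow> dist (\<xi> r) (\<xi> s) < e" using \<delta>(1) by blast
qed

lemma division_real_endpoints:
  assumes D: "D division_of \<Union>D" "\<Union>D \<subseteq> {a..b}" "K \<in> D"
  shows "Sup K \<in> {a..b}" "Inf K \<in> {a..b}" "Inf K \<le> (Sup K :: real)"
proof -
  obtain c d where cd: "K = {c..d}" "c \<le> d" "Inf K = c" "Sup K = d"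
    using division_real_memE[OF D(1,3)] by blast
  have "{c..d} \<subseteq> {a..b}" using D(2,3) cd(1) by blast
  with cd show "Sup K \<in> {a..b}" "Inf K \<in> {a..b}" "Inf K \<le> Sup K" by auto
qed

lemma abs_continuous_on_compose_Lipschitz:
  assumes ac: "abs_continuous_on a b \<xi>"
    and lip: "\<And>r s. r \<in> {a..b} \<Longrightarrow> s \<in> {a..b} \<Longrightarrow> norm (\<eta> s - \<eta> r) \<le> C * norm (\<xi> s - \<xi> r)"
  shows "abs_continuous_on a b \<eta>"
  unfolding abs_continuous_on_def
proof (intro allI impI)
  fix e :: real assume "e > 0"
  then have "e / (\<bar>C\<bar> + 1) > 0" by simp
  then obtain \<delta> where \<delta>: "\<delta> > 0" "\<And>D. D division_of \<Union>D \<and> \<Union>D \<subseteq> {a..b} \<and>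
     (\<Sum>K\<in>D. Sup K - Inf K) < \<delta> \<Longrightarrow> (\<Sum>K\<in>D. norm (\<xi> (Sup K) - \<xi> (Inf K))) < e / (\<bar>C\<bar> + 1)"
    using ac unfolding abs_continuous_on_def by blast
  show "\<exists>\<delta>>0. \<forall>D. D division_of \<Union> D \<and> \<Union> D \<subseteq> {a..b} \<and> (\<Sum>K\<in>D. Sup K - Inf K) < \<delta> \<longrightarrow>
             (\<Sum>K\<in>D. norm (\<eta> (Sup K) - \<eta> (Inf K))) < e"
  proof (intro exI[of _ \<delta>] conjI allI impI)
    show "\<delta> > 0" by fact
    fix D assume D: "D division_of \<Union> D \<and> \<Union> D \<subseteq> {a..b} \<and> (\<Sum>K\<in>D. Sup K - Inf K) < \<delta>"
    have "(\<Sum>K\<in>D. norm (\<eta> (Sup K) - \<eta> (Inf K))) \<le> (\<Sum>K\<in>D. (\<bar>C\<bar> + 1) * norm (\<xi> (Sup K) - \<xi> (Inf K)))"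
    proof (rule sum_mono)
      fix K assume K: "K \<in> D"
      then have "Sup K \<in> {a..b}" "Inf K \<in> {a..b}" using division_real_endpoints D by blast+
      from lip[OF this(2,1)] show "norm (\<eta> (Sup K) - \<eta> (Inf K)) \<le> (\<bar>C\<bar> + 1) * norm (\<xi> (Sup K) - \<xi> (Inf K))"
        by (rule order_trans) (intro mult_right_mono, auto)
    qed
    also have "\<dots> = (\<bar>C\<bar> + 1) * (\<Sum>K\<in>D. norm (\<xi> (Sup K) - \<xi> (Inf K)))" by (simp add: sum_distrib_left)
    also have "\<dots> < e" using \<delta>(2)[OF D] by (simp add: field_simps)
    finally show "(\<Sum>K\<in>D. norm (\<eta> (Sup K) - \<eta> (Inf K))) < e" .
  qed
qed

text \<open>On short divisions the displacements of \<open>\<xi>\<close> are small by absolute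
  continuity and the elapsed times by assumption. For the value function along a curve the bound
  comes from Lipschitz continuity in space and a growth bound in time.\<close>

lemma upper_abs_continuousI:
  assumes ac: "abs_continuous_on a b \<xi>" and "C \<ge> 0"
    and lip: "\<And>r s. r \<in> {a..b} \<Longrightarrow> s \<in> {a..b} \<Longrightarrow> r \<le> s \<Longrightarrow> \<phi> s - \<phi> r \<le> C * (norm (\<xi> s - \<xi> r) + (s - r))"
  shows "upper_abs_continuous a b \<phi>"
  unfolding upper_abs_continuous_def
proof (intro allI impI)
  fix e :: real assume "e > 0"
  then have e': "e / (2 * (C + 1)) > 0" using \<open>C \<ge> 0\<close> by simp
  then obtain \<delta> where \<delta>: "\<delta> > 0" "\<And>D. D division_of \<Union>D \<and> \<Union>D \<subseteq> {a..b} \<and>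
     (\<Sum>K\<in>D. Sup K - Inf K) < \<delta> \<Longrightarrow> (\<Sum>K\<in>D. norm (\<xi> (Sup K) - \<xi> (Inf K))) < e / (2 * (C + 1))"
    using ac unfolding abs_continuous_on_def by blast
  let ?\<delta> = "min \<delta> (e / (2 * (C + 1)))"
  show "\<exists>\<delta>>0. \<forall>D. D division_of \<Union> D \<and> \<Union> D \<subseteq> {a..b} \<and> (\<Sum>K\<in>D. Sup K - Inf K) < \<delta> \<longrightarrow>
             (\<Sum>K\<in>D. \<phi> (Sup K) - \<phi> (Inf K)) < e"
  proof (intro exI[of _ ?\<delta>] conjI allI impI)
    show "?\<delta> > 0" using \<delta>(1) e' by simp
    fix D assume D: "D division_of \<Union> D \<and> \<Union> D \<subseteq> {a..b} \<and> (\<Sum>K\<in>D. Sup K - Inf K) < ?\<delta>"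
    have "(\<Sum>K\<in>D. \<phi> (Sup K) - \<phi> (Inf K)) \<le>
        (\<Sum>K\<in>D. (C + 1) * (norm (\<xi> (Sup K) - \<xi> (Inf K)) + (Sup K - Inf K)))"
    proof (rule sum_mono)
      fix K assume K: "K \<in> D"
      then have cd: "Sup K \<in> {a..b}" "Inf K \<in> {a..b}" "Inf K \<le> Sup K"
        using division_real_endpoints D by blast+
      from lip[OF cd(2,1,3)]
      show "\<phi> (Sup K) - \<phi> (Inf K) \<le> (C + 1) * (norm (\<xi> (Sup K) - \<xi> (Inf K)) + (Sup K - Inf K))"
        by (rule order_trans) (use cd in \<open>intro mult_right_mono, auto\<close>)
    qed
    also have "\<dots> = (C + 1) * (\<Sum>K\<in>D. norm (\<xi> (Sup K) - \<xi> (Inf K))) + (C + 1) * (\<Sum>K\<in>D. Sup K - Inf K)"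
      by (simp only: sum_distrib_left sum.distrib distrib_left)
    also have "\<dots> < (C + 1) * (e / (2 * (C + 1))) + (C + 1) * (e / (2 * (C + 1)))"
      using \<delta>(2)[of D] D \<open>C \<ge> 0\<close> by (intro add_strict_mono mult_strict_left_mono) auto
    also have "\<dots> = e"
    proof -
      have "c * (e / (2 * c)) + c * (e / (2 * c)) = e" if "c > 0" for c using that by (simp add: field_simps)
      from this[of "C + 1"] show ?thesis using \<open>C \<ge> 0\<close> by linarith
    qed
    finally show "(\<Sum>K\<in>D. \<phi> (Sup K) - \<phi> (Inf K)) < e" .
  qed
qed

section \<open>Horizontal vectors and the horizontal derivative\<close>

text \<open>The row vector \<open>q\<close> times the transpose of \<open>Bmat x\<close>: the
  velocity that the control \<open>q\<close> produces at \<open>x\<close>.\<close>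

definition hvel :: "real^3 \<Rightarrow> real^2 \<Rightarrow> real^3" where
  "hvel x q = vector [q$1, q$2, - x$2 * q$1 + x$1 * q$2]"

definition hpart :: "real^3 \<Rightarrow> real^2" where
  "hpart v = vector [v$1, v$2]"

text \<open>The contact form \<open>dx\<^sub>3 + x\<^sub>2 dx\<^sub>1 - x\<^sub>1 dx\<^sub>2\<close>: its kernel at \<open>x\<close> consists of the horizontal
  vectors \<open>hvel x q\<close>.\<close>

definition contact :: "real^3 \<Rightarrow> real^3 \<Rightarrow> real" where
  "contact x v = v$3 + x$2 * v$1 - x$1 * v$2"

lemma hvel_nth [simp]:
  "hvel x q $ 1 = q$1" "hvel x q $ 2 = q$2" "hvel x q $ 3 = - x$2 * q$1 + x$1 * q$2"
  by (simp_all add: hvel_def)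

lemma hpart_nth [simp]: "hpart v $ 1 = v$1" "hpart v $ 2 = v$2"
  by (simp_all add: hpart_def)

lemma norm_real2_sq: "(norm (h::real^2))\<^sup>2 = (h$1)\<^sup>2 + (h$2)\<^sup>2"
  unfolding power2_norm_eq_inner inner_vec_def sum_2 by (simp add: power2_eq_square)

lemma norm_real3_sq: "(norm (h::real^3))\<^sup>2 = (h$1)\<^sup>2 + (h$2)\<^sup>2 + (h$3)\<^sup>2"
  unfolding power2_norm_eq_inner inner_vec_def sum_3 by (simp add: power2_eq_square)

lemma norm_hpart_le: "norm (hpart v) \<le> norm v"
  by (rule power2_le_imp_le) (simp_all add: norm_real2_sq norm_real3_sq)

text \<open>Lagrange's identity: the squared determinant and the squared inner product add up to the
  product of the squared norms.\<close>

lemma abs_det2_le: "\<bar>a$1 * b$2 - a$2 * b$1\<bar> \<le> norm (a::real^2) * norm (b::real^2)"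
proof -
  have "(a$1 * b$2 - a$2 * b$1)\<^sup>2 \<le> (norm a)\<^sup>2 * (norm b)\<^sup>2"
    unfolding norm_real2_sq using zero_le_power2[of "a$1 * b$1 + a$2 * b$2"]
    by (simp add: power2_eq_square algebra_simps)
  then have "\<bar>a$1 * b$2 - a$2 * b$1\<bar>\<^sup>2 \<le> (norm a * norm b)\<^sup>2" by (simp add: power_mult_distrib)
  then show ?thesis by (rule power2_le_imp_le) simp
qed

lemma norm_real3_le: "norm (v::real^3) \<le> norm (hpart v) + \<bar>v$3\<bar>"
  by (rule power2_le_imp_le) (simp_all add: norm_real3_sq norm_real2_sq power2_sum)

text \<open>The third coordinate of \<open>v\<close> is its contact form plus a determinant of
  horizontal parts. This converts horizontal and vertical estimates into the Euclidean distances
  that Lipschitz bounds require.\<close>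

lemma norm_le_hpart_contact: "norm v \<le> (1 + norm x) * norm (hpart v) + \<bar>contact x v\<bar>"
proof -
  have "\<bar>v$3\<bar> \<le> \<bar>contact x v\<bar> + \<bar>hpart x $ 1 * hpart v $ 2 - hpart x $ 2 * hpart v $ 1\<bar>"
    by (simp add: contact_def)
  also have "\<dots> \<le> \<bar>contact x v\<bar> + norm x * norm (hpart v)"
    using abs_det2_le[of "hpart x" "hpart v"] norm_hpart_le[of x]
    by (meson add_left_mono mult_right_mono norm_ge_zero order_trans)
  finally show ?thesis using norm_real3_le[of v] by (simp add: algebra_simps)
qed

lemma hpart_hvel [simp]: "hpart (hvel x q) = q"
  by (simp add: vec_eq_iff forall_2)

text \<open>Measures how far a vector horizontal at \<open>y\<close> is from being horizontal at
  \<open>x\<close>. The determinant is bilinear in the displacement and the control, hence of second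
  order along a short trajectory.\<close>

lemma contact_hvel: "contact x (hvel y q) = hpart (y - x) $ 1 * q$2 - hpart (y - x) $ 2 * q$1"
  by (simp add: contact_def algebra_simps)

lemma contact_hvel_self [simp]: "contact x (hvel x q) = 0"
  by (simp add: contact_hvel)

lemma norm_hvel_le: "norm (hvel x q) \<le> (1 + norm x) * norm q"
  using norm_le_hpart_contact[of "hvel x q" x] by simp

lemma abs_contact_hvel_le: "\<bar>contact x (hvel y q)\<bar> \<le> norm (hpart (y - x)) * norm q"
  unfolding contact_hvel by (rule abs_det2_le)

lemma abs_contact_le: "\<bar>contact x v\<bar> \<le> (1 + norm x) * norm v"
proof -
  have "\<bar>contact x v\<bar> \<le> \<bar>v$3\<bar> + \<bar>hpart x $ 1 * hpart v $ 2 - hpart x $ 2 * hpart v $ 1\<bar>"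
    by (simp add: contact_def)
  also have "\<dots> \<le> norm v + norm x * norm v"
    using abs_det2_le[of "hpart x" "hpart v"] component_le_norm_cart[of v 3]
      norm_hpart_le[of x] norm_hpart_le[of v]
    by (meson add_mono mult_mono norm_ge_zero order_trans)
  finally show ?thesis by (simp add: algebra_simps)
qed

lemma contact_eq_inner: "contact x v = vector [x$2, - x$1, 1] \<bullet> v"
  by (simp add: contact_def inner_vec_def sum_3)

lemma hpart_inner: "w \<bullet> hpart v = vector [w$1, w$2, 0] \<bullet> v"
  by (simp add: inner_vec_def sum_3 sum_2)

lemma hpart_diff: "hpart (v - w) = hpart v - hpart w"
  and hpart_add: "hpart (v + w) = hpart v + hpart w"
  and hpart_scaleR: "hpart (c *\<^sub>R v) = c *\<^sub>R hpart v"
  by (simp_all add: vec_eq_iff forall_2)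

lemma contact_add: "contact x (v + w) = contact x v + contact x w"
  by (simp add: contact_def algebra_simps)

lemma contact_scaleR: "contact x (c *\<^sub>R v) = c * contact x v"
  by (simp add: contact_def algebra_simps)

lemma hvel_minus: "hvel x (- q) = - hvel x q"
  by (simp add: vec_eq_iff forall_3)

section \<open>The horizontal derivative\<close>

lemma has_H_derivative_alt:
  "has_H_derivative w p x \<longleftrightarrow> ((\<lambda>h. (w (x + hvel x h) - w x - p \<bullet> h) / norm h) \<longlongrightarrow> 0) (at 0)"
proof -
  have "vector [x$1 + h$1, x$2 + h$2, x$3 - x$2 * h$1 + x$1 * h$2] = x + hvel x h" for h :: "real^2"
    by (simp add: vec_eq_iff forall_3)
  then show ?thesis by (simp add: has_H_derivative_def)
qed

lemma has_H_derivativeD: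
  assumes "has_H_derivative w p x" "e > 0"
  obtains d where "d > 0"
    "\<And>h. norm h < d \<Longrightarrow> \<bar>w (x + hvel x h) - w x - p \<bullet> h\<bar> \<le> e * norm h"
proof -
  obtain d where d: "d > 0"
    "\<And>h. h \<noteq> 0 \<Longrightarrow> norm h < d \<Longrightarrow> \<bar>(w (x + hvel x h) - w x - p \<bullet> h) / norm h\<bar> < e"
    using assms unfolding has_H_derivative_alt LIM_def by auto
  have h0: "hvel x 0 = 0" by (simp add: vec_eq_iff forall_3)
  have "\<bar>w (x + hvel x h) - w x - p \<bullet> h\<bar> \<le> e * norm h" if "norm h < d" for h
    using d(2)[of h] that by (cases "h = 0") (auto simp: h0 abs_divide field_simps)
  then show ?thesis using that d(1) by blast
qed

text \<open>Testing with a small \<open>h\<close> along \<open>p - q\<close> gives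
  \<open>norm (p - q) * norm h \<le> (B + e) * norm h\<close>. The lemma yields both the uniqueness
  of the derivative and the boundedness of the feedback control.\<close>

lemma has_H_derivative_le:
  assumes H: "has_H_derivative w p x" and q: "\<And>h. w (x + hvel x h) - w x \<le> q \<bullet> h + B * norm h"
  shows "norm (p - q) \<le> B"
proof (rule field_le_epsilon)
  fix e :: real assume "e > 0"
  obtain d where d: "d > 0" "\<And>h. norm h < d \<Longrightarrow> \<bar>w (x + hvel x h) - w x - p \<bullet> h\<bar> \<le> e * norm h"
    using has_H_derivativeD[OF H \<open>e > 0\<close>] by blast
  show "norm (p - q) \<le> B + e"
  proof (cases "p = q")
    case True
    \<comment> \<open>For \<open>p = q\<close> only the sign of \<open>B + e\<close> is at stake,
      and any increment of norm \<open>d/2\<close> decides it.\<close>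
    define h :: "real^2" where "h = (d/2) *\<^sub>R axis 1 1"
    have h: "norm h = d/2" "norm (-h) = d/2" using d(1) by (simp_all add: h_def norm_eq_1 inner_axis_axis)
    have "p \<bullet> h - e * (d/2) \<le> q \<bullet> h + B * (d/2)" 
    proof -
      have "\<bar>w (x + hvel x h) - w x - p \<bullet> h\<bar> \<le> e * (d/2)" using d(2)[of h] h d(1) by simp
      moreover have "w (x + hvel x h) - w x \<le> q \<bullet> h + B * (d/2)" using q[of h] h by simp
      ultimately show ?thesis by linarith
    qed
    then have "0 \<le> (d/2) * (B + e)" using True by (simp add: algebra_simps)
    then show ?thesis using True d(1) by (simp add: zero_le_mult_iff)
  next
    case False
    define n where "n = norm (p - q)"
    have n: "n > 0" using False by (simp add: n_def)
    define h where "h = (d / (2 * n)) *\<^sub>R (p - q)"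
    have h: "norm h = d/2" using n d(1) by (simp add: h_def flip: n_def)
    have "(p - q) \<bullet> h = n * (d/2)"
      using n by (simp add: h_def flip: power2_norm_eq_inner n_def) (simp add: power2_eq_square)
    moreover have "p \<bullet> h - e * (d/2) \<le> q \<bullet> h + B * (d/2)"
    proof -
      have "\<bar>w (x + hvel x h) - w x - p \<bullet> h\<bar> \<le> e * (d/2)" using d(2)[of h] h d(1) by simp
      moreover have "w (x + hvel x h) - w x \<le> q \<bullet> h + B * (d/2)" using q[of h] h by simp
      ultimately show ?thesis by linarith
    qed
    ultimately have "n * (d/2) \<le> (B + e) * (d/2)" by (simp add: inner_diff_left algebra_simps)
    then show ?thesis using d(1) by (simp add: n_def)
  qed
qed

text \<open>The difference of two derivatives of \<open>w\<close> is a derivative of the zero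
  function.\<close>

lemma has_H_derivative_unique:
  assumes p: "has_H_derivative w p x" and q: "has_H_derivative w q x"
  shows "p = q"
proof -
  have "((\<lambda>h. (w (x + hvel x h) - w x - p \<bullet> h) / norm h - (w (x + hvel x h) - w x - q \<bullet> h) / norm h) \<longlongrightarrow> 0 - 0) (at 0)"
    using p q unfolding has_H_derivative_alt by (intro tendsto_diff)
  moreover have "(w (x + hvel x h) - w x - p \<bullet> h) / norm h - (w (x + hvel x h) - w x - q \<bullet> h) / norm h
      = (0 - 0 - (p - q) \<bullet> h) / norm h" for h
    by (simp add: diff_divide_distrib inner_diff_left)
  ultimately have "has_H_derivative (\<lambda>_. 0) (p - q) x" by (simp add: has_H_derivative_alt)
  from has_H_derivative_le[OF this, of 0 0] show ?thesis by simp
qed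

lemma H_differentiable_D_H: "H_differentiable w x \<Longrightarrow> has_H_derivative w (D_H w x) x"
  unfolding H_differentiable_def D_H_def by (metis has_H_derivative_unique theI)

section \<open>Admissible trajectories\<close>

definition energy :: "(real \<Rightarrow> real^2) \<Rightarrow> real \<Rightarrow> real \<Rightarrow> real" where
  "energy \<beta> a b = integral {a..b} (\<lambda>s. (norm (\<beta> s))\<^sup>2)"

lemma integral_affine:
  fixes F :: "real \<Rightarrow> real"
  assumes "F integrable_on {a..b}" "a \<le> b"
  shows "integral {a..b} (\<lambda>s. A + B * F s) = (b - a) * A + B * integral {a..b} F"
  using has_integral_add[OF has_integral_const_real[of A a b] has_integral_mult_right[OF integrable_integral[OF assms(1)], of B]]
    assms(2) by (simp add: integral_unique)

lemma AE_lebesgue_on_subset: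
  assumes "AE s in lebesgue_on S. P s" "R \<subseteq> S" "S \<in> sets lebesgue" "R \<in> sets lebesgue"
  shows "AE s in lebesgue_on R. P s"
proof -
  obtain N where "negligible N" "\<And>s. s \<in> S - N \<Longrightarrow> P s"
    using AE_lebesgue_on_negligibleE[OF assms(1,3)] by blast
  then show ?thesis using assms(2,4) by (intro AE_lebesgue_on_negligibleI) auto
qed

lemma admissible_iff:
  "(\<eta>, \<beta>) \<in> admissible T x a \<longleftrightarrow> abs_continuous_on a T \<eta> \<and> square_integrable_on a T \<beta> \<and> \<eta> a = x \<and>
     (AE s in lebesgue_on {a..T}. (\<eta> has_vector_derivative hvel (\<eta> s) (\<beta> s)) (at s within {a..T}))"
  by (simp add: admissible_def hvel_def)

lemma energy_absolutely_integrable: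
  assumes "(\<eta>, \<beta>) \<in> admissible T x a" "a \<le> c" "d \<le> T"
  shows "(\<lambda>s. (norm (\<beta> s))\<^sup>2) absolutely_integrable_on {c..d}"
proof -
  have "(\<lambda>s. (norm (\<beta> s))\<^sup>2) absolutely_integrable_on {a..T}"
    using assms(1) by (simp add: admissible_iff square_integrable_on_def integrable_lebesgue_on_iff)
  then show ?thesis by (rule set_integrable_subset) (use assms in auto)
qed

lemma energy_integrable:
  assumes "(\<eta>, \<beta>) \<in> admissible T x a" "a \<le> c" "d \<le> T"
  shows "(\<lambda>s. (norm (\<beta> s))\<^sup>2) integrable_on {c..d}"
  using energy_absolutely_integrable[OF assms] by (simp add: absolutely_integrable_on_def)

lemma energy_nonneg: "0 \<le> energy \<beta> a b"
  \<comment> \<open>Without integrability the integral has the default value 0.\<close>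
  unfolding energy_def by (cases "(\<lambda>s. (norm (\<beta> s))\<^sup>2) integrable_on {a..b}")
    (auto intro: integral_nonneg simp: not_integrable_integral)

lemma energy_combine:
  assumes "(\<eta>, \<beta>) \<in> admissible T x a" "a \<le> b" "b \<le> T"
  shows "energy \<beta> a b + energy \<beta> b T = energy \<beta> a T"
  unfolding energy_def using assms by (intro Henstock_Kurzweil_Integration.integral_combine energy_integrable[OF assms(1)]) auto

lemma energy_mono:
  assumes adm: "(\<eta>, \<beta>) \<in> admissible T x a" and "a \<le> r" "r \<le> b" "b \<le> T"
  shows "energy \<beta> a r \<le> energy \<beta> a b"
  unfolding energy_def using assms by (intro integral_subset_le energy_integrable[OF adm]) auto

lemma admissible_restrict:
  assumes adm: "(\<eta>, \<beta>) \<in> admissible T x a" and ab: "a \<le> b" "b \<le> T"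
  shows "(\<eta>, \<beta>) \<in> admissible T (\<eta> b) b"
  unfolding admissible_iff
proof (intro conjI)
  have sub: "{b..T} \<subseteq> {a..T}" using ab by auto
  show "abs_continuous_on b T \<eta>"
    using adm ab by (auto simp: admissible_iff intro: abs_continuous_on_subinterval)
  show "square_integrable_on b T \<beta>"
    unfolding square_integrable_on_def
  proof
    show "\<beta> \<in> borel_measurable (lebesgue_on {b..T})"
      using adm sub by (auto simp: admissible_iff square_integrable_on_def intro: measurable_restrict_mono)
    show "integrable (lebesgue_on {b..T}) (\<lambda>s. (norm (\<beta> s))\<^sup>2)"
      using energy_absolutely_integrable[OF adm ab(1) order_refl] by (simp add: integrable_lebesgue_on_iff)
  qed
  have "AE s in lebesgue_on {b..T}. (\<eta> has_vector_derivative hvel (\<eta> s) (\<beta> s)) (at s within {a..T})"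
    by (rule AE_lebesgue_on_subset[OF _ sub]) (use adm in \<open>simp_all add: admissible_iff\<close>)
  then show "AE s in lebesgue_on {b..T}. (\<eta> has_vector_derivative hvel (\<eta> s) (\<beta> s)) (at s within {b..T})"
    by eventually_elim (rule has_vector_derivative_within_subset[OF _ sub])
qed simp

text \<open>Pairing with a fixed vector \<open>v\<close> reduces the state equation to a scalar one.
  The horizontal and the vertical distance bounds for trajectories arise from choices of
  \<open>v\<close> and \<open>k\<close>.\<close>

lemma admissible_inner_le:
  assumes adm: "(\<eta>, \<beta>) \<in> admissible T x a" and "a \<le> c" "c \<le> d" "d \<le> T"
    and k: "k absolutely_integrable_on {c..d}"
    and le: "\<And>s. s \<in> {c..d} \<Longrightarrow> v \<bullet> hvel (\<eta> s) (\<beta> s) \<le> k s"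
  shows "v \<bullet> (\<eta> d - \<eta> c) \<le> integral {c..d} k"
proof -
  have sub: "{c..d} \<subseteq> {a..T}" using assms by auto
  have "abs_continuous_on c d \<eta>"
    using adm assms(2-4) by (auto simp: admissible_iff intro: abs_continuous_on_subinterval)
  then have "upper_abs_continuous c d (\<lambda>s. v \<bullet> \<eta> s)"
  proof (rule upper_abs_continuousI)
    fix r s :: real assume "r \<le> s"
    have "v \<bullet> (\<eta> s - \<eta> r) \<le> norm v * norm (\<eta> s - \<eta> r)" by (rule norm_cauchy_schwarz)
    also have "\<dots> \<le> norm v * (norm (\<eta> s - \<eta> r) + (s - r))" using \<open>r \<le> s\<close> by (intro mult_left_mono) auto
    finally show "v \<bullet> \<eta> s - v \<bullet> \<eta> r \<le> norm v * (norm (\<eta> s - \<eta> r) + (s - r))" by (simp add: inner_diff_right)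
  qed simp
  moreover have "AE s in lebesgue_on {c..d}. \<exists>e\<le>k s. ((\<lambda>s. v \<bullet> \<eta> s) has_vector_derivative e) (at s within {c..d})"
  proof -
    obtain N where N: "negligible N"
      "\<And>s. s \<in> {a..T} - N \<Longrightarrow> (\<eta> has_vector_derivative hvel (\<eta> s) (\<beta> s)) (at s within {a..T})"
      using adm AE_lebesgue_on_negligibleE[where S="{a..T}"] unfolding admissible_iff by auto
    show ?thesis
    proof (rule AE_lebesgue_on_negligibleI[OF N(1)])
      fix s assume s: "s \<in> {c..d} - N"
      then have "(\<eta> has_vector_derivative hvel (\<eta> s) (\<beta> s)) (at s within {c..d})"
        using N(2)[of s] sub has_vector_derivative_within_subset by blast
      then have "((\<lambda>s. v \<bullet> \<eta> s) has_vector_derivative v \<bullet> hvel (\<eta> s) (\<beta> s)) (at s within {c..d})"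
        by (rule bounded_linear.has_vector_derivative[OF bounded_linear_inner_right])
      then show "\<exists>e\<le>k s. ((\<lambda>s. v \<bullet> \<eta> s) has_vector_derivative e) (at s within {c..d})"
        using le[of s] s by blast
    qed simp
  qed
  ultimately have "v \<bullet> \<eta> d - v \<bullet> \<eta> c \<le> integral {c..d} k"
    by (rule upper_abs_continuous_derivative_le[OF \<open>c \<le> d\<close> _ k])
  then show ?thesis by (simp add: inner_diff_right)
qed

text \<open>Cauchy-Schwarz in time, as the horizontal velocity is the control itself. It is obtained
  by duality: Young's inequality is integrated for a fixed vector \<open>w\<close>, which is then
  optimised.\<close>

lemma admissible_hpart_bound:
  assumes adm: "(\<eta>, \<beta>) \<in> admissible T x a" and "a \<le> r" "r \<le> T"
  shows "(norm (hpart (\<eta> r - x)))\<^sup>2 \<le> (r - a) * energy \<beta> a r"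
proof (cases "r = a")
  case True
  then show ?thesis using adm by (simp add: admissible_iff norm_real2_sq)
next
  case False
  define h where "h = r - a"
  have h: "h > 0" using False assms by (simp add: h_def)
  define \<Delta> where "\<Delta> = hpart (\<eta> r - x)"
  \<comment> \<open>the optimal choice in \<open>w \<bullet> \<Delta> \<le> h |w|\<^sup>2/2 + energy/2\<close>\<close>
  define w where "w = \<Delta> /\<^sub>R h"
  let ?k = "\<lambda>s. (norm w)\<^sup>2 / 2 + (norm (\<beta> s))\<^sup>2 / 2"
  have en: "(\<lambda>s. (norm (\<beta> s))\<^sup>2) absolutely_integrable_on {a..r}"
    using energy_absolutely_integrable[OF adm] assms by simp
  have x: "\<eta> a = x" using adm by (simp add: admissible_iff)
  have "vector [w$1, w$2, 0] \<bullet> (\<eta> r - \<eta> a) \<le> integral {a..r} ?k"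
  proof (rule admissible_inner_le[OF adm])
    show "?k absolutely_integrable_on {a..r}"
      using en by (intro set_integral_add(1) absolutely_integrable_on_const set_integrable_divide) auto
    fix s
    have "w \<bullet> \<beta> s \<le> ?k s"
      using inner_ge_zero[of "w - \<beta> s"] by (simp add: power2_norm_eq_inner inner_diff inner_commute)
    then show "vector [w$1, w$2, 0] \<bullet> hvel (\<eta> s) (\<beta> s) \<le> ?k s"
      using hpart_inner[of w "hvel (\<eta> s) (\<beta> s)"] by simp
  qed (use assms in auto)
  also have "integral {a..r} ?k = h * (norm w)\<^sup>2 / 2 + energy \<beta> a r / 2"
    using integral_affine[of "\<lambda>s. (norm (\<beta> s))\<^sup>2" a r "(norm w)\<^sup>2 / 2" "1/2"] en \<open>a \<le> r\<close>
    by (simp add: absolutely_integrable_on_def energy_def h_def)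
  finally have "w \<bullet> \<Delta> \<le> h * (norm w)\<^sup>2 / 2 + energy \<beta> a r / 2"
    by (simp add: \<Delta>_def x flip: hpart_inner)
  moreover have "w \<bullet> \<Delta> = (norm \<Delta>)\<^sup>2 / h" "(norm w)\<^sup>2 = (norm \<Delta>)\<^sup>2 / h\<^sup>2"
    using h by (simp_all add: w_def dot_square_norm power_divide field_simps)
  ultimately have "(norm \<Delta>)\<^sup>2 / h \<le> (norm \<Delta>)\<^sup>2 / h / 2 + energy \<beta> a r / 2"
    using h by (simp add: power2_eq_square)
  then have "(norm \<Delta>)\<^sup>2 / h \<le> energy \<beta> a r" by simp
  then show ?thesis using h by (simp add: \<Delta>_def h_def field_simps)
qed

text \<open>The velocity at time \<open>s\<close> has contact form at most
  \<open>norm (hpart (\<eta> s - x)) * norm (\<beta> s)\<close>, and its first factor is already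
  controlled by the energy. The vertical displacement is therefore quadratic in the horizontal
  scale.\<close>

lemma admissible_contact_bound:
  assumes adm: "(\<eta>, \<beta>) \<in> admissible T x a" and "a \<le> r" "r \<le> T"
  shows "\<bar>contact x (\<eta> r - x)\<bar> \<le> (r - a) * energy \<beta> a r"
proof (cases "r = a")
  case True
  then show ?thesis using adm by (simp add: admissible_iff contact_def)
next
  case False
  define h where "h = r - a"
  have h: "h > 0" using False assms by (simp add: h_def)
  let ?E = "energy \<beta> a r"
  \<comment> \<open>Young's inequality weighted by \<open>h\<close>: each summand integrates to half
    of \<open>h * ?E\<close>.\<close>
  let ?k = "\<lambda>s. ?E / 2 + h * (norm (\<beta> s))\<^sup>2 / 2"
  let ?v = "vector [x$2, - x$1, 1] :: real^3"
  have en: "(\<lambda>s. (norm (\<beta> s))\<^sup>2) absolutely_integrable_on {a..r}"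
    using energy_absolutely_integrable[OF adm] assms by simp
  have x: "\<eta> a = x" using adm by (simp add: admissible_iff)
  have k: "?k absolutely_integrable_on {a..r}"
    using en by (intro set_integral_add(1) absolutely_integrable_on_const set_integrable_divide set_integrable_mult_right) auto
  have int: "integral {a..r} ?k = h * ?E"
    using integral_affine[of "\<lambda>s. (norm (\<beta> s))\<^sup>2" a r "?E / 2" "h / 2"] en \<open>a \<le> r\<close>
    by (simp add: absolutely_integrable_on_def energy_def[symmetric] h_def[symmetric])
  have le: "\<bar>contact x (hvel (\<eta> s) (\<beta> s))\<bar> \<le> ?k s" if s: "s \<in> {a..r}" for s
  proof -
    let ?n = "norm (hpart (\<eta> s - x))" and ?b = "norm (\<beta> s)"
    have "?n\<^sup>2 \<le> (s - a) * energy \<beta> a s" using admissible_hpart_bound[OF adm, of s] s assms by simp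
    also have "\<dots> \<le> h * ?E"
      using energy_mono[OF adm, of s r] energy_nonneg s assms by (intro mult_mono) (auto simp: h_def)
    finally have "?n\<^sup>2 / h \<le> ?E" using h by (simp add: field_simps)
    moreover have "2 * (?n * ?b) \<le> ?n\<^sup>2 / h + h * ?b\<^sup>2"
    proof -
      have "0 \<le> (?n - h * ?b)\<^sup>2 / h" using h by simp
      also have "\<dots> = ?n\<^sup>2 / h - 2 * (?n * ?b) + h * ?b\<^sup>2" using h by (simp add: power2_eq_square field_simps)
      finally show ?thesis by simp
    qed
    moreover have "\<bar>contact x (hvel (\<eta> s) (\<beta> s))\<bar> \<le> ?n * ?b" by (rule abs_contact_hvel_le)
    ultimately show ?thesis by linarith
  qed
  have "?v \<bullet> (\<eta> r - \<eta> a) \<le> integral {a..r} ?k"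
  proof (rule admissible_inner_le[OF adm _ _ _ k])
    show "?v \<bullet> hvel (\<eta> s) (\<beta> s) \<le> ?k s" if "s \<in> {a..r}" for s
      using le[OF that] by (simp add: contact_eq_inner)
  qed (use assms in auto)
  moreover have "(- ?v) \<bullet> (\<eta> r - \<eta> a) \<le> integral {a..r} ?k"
  proof (rule admissible_inner_le[OF adm _ _ _ k])
    show "(- ?v) \<bullet> hvel (\<eta> s) (\<beta> s) \<le> ?k s" if "s \<in> {a..r}" for s
      using le[OF that] by (simp add: contact_eq_inner)
  qed (use assms in auto)
  ultimately show ?thesis unfolding int by (simp add: contact_eq_inner x h_def)
qed

text \<open>A competitor of zero energy: it makes the infimum range over a nonempty set and bounds
  \<open>u\<close> from above.\<close>

lemma admissible_const: "a \<le> T \<Longrightarrow> ((\<lambda>_. x), (\<lambda>_. 0)) \<in> admissible T x a"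
  by (auto simp: admissible_iff abs_continuous_on_def square_integrable_on_def hvel_def vec_eq_iff forall_3
      intro!: exI[of _ 1] has_vector_derivative_eq_rhs[OF has_vector_derivative_const])

text \<open>\<open>heis_shift x (y - x)\<close> is the left translation of the Heisenberg group taking \<open>x\<close> to \<open>y\<close>.\<close>

definition heis_shift :: "real^3 \<Rightarrow> real^3 \<Rightarrow> real^3 \<Rightarrow> real^3" where
  "heis_shift x d v = v + vector [d$1, d$2, d$3 - d$2 * (v$1 - x$1) + d$1 * (v$2 - x$2)]"

lemma norm_heis_shift_diff_le:
  "norm (heis_shift x d v - v) \<le> norm d * (1 + norm (hpart (v - x)))"
proof -
  let ?c = "hpart d $ 1 * hpart (v - x) $ 2 - hpart d $ 2 * hpart (v - x) $ 1"
  have "heis_shift x d v - v = d + ?c *\<^sub>R axis 3 1"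
    by (simp add: heis_shift_def vec_eq_iff forall_3 axis_def algebra_simps)
  then have "norm (heis_shift x d v - v) \<le> norm d + \<bar>?c\<bar>"
    by (metis norm_axis_1 norm_scaleR mult.right_neutral norm_triangle_ineq)
  also have "\<bar>?c\<bar> \<le> norm d * norm (hpart (v - x))"
    using abs_det2_le[of "hpart d" "hpart (v - x)"] norm_hpart_le[of d]
    by (meson mult_right_mono norm_ge_zero order_trans)
  finally show ?thesis by (simp add: algebra_simps)
qed

text \<open>Left translations preserve horizontal directions, so the translated curve keeps its
  control and thus its energy.\<close>

lemma admissible_heis_shift:
  assumes adm: "(\<eta>, \<beta>) \<in> admissible T x a"
  shows "((\<lambda>s. heis_shift x d (\<eta> s)), \<beta>) \<in> admissible T (x + d) a"
proof -
  \<comment> \<open>The translation is affine with linear part \<open>A\<close>, which maps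
    \<open>hvel v q\<close> to the horizontal vector with the same \<open>q\<close> at the
    translated point.\<close>
  define A :: "real^3 \<Rightarrow> real^3" where "A v = v + vector [0, 0, - d$2 * v$1 + d$1 * v$2]" for v
  have "linear A"
    by (rule linearI) (simp_all add: A_def vec_eq_iff forall_3 algebra_simps)
  then have A: "bounded_linear A" by (simp add: linear_conv_bounded_linear)
  have shift: "heis_shift x d v = A v + vector [d$1, d$2, d$3 + d$2 * x$1 - d$1 * x$2]" for v
    by (simp add: heis_shift_def A_def vec_eq_iff forall_3 algebra_simps)
  have hv: "A (hvel v q) = hvel (heis_shift x d v) q" for v q
    by (simp add: heis_shift_def A_def vec_eq_iff forall_3 algebra_simps)
  obtain K where K: "\<And>v. norm (A v) \<le> norm v * K" using A bounded_linear.bounded by blast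
  show ?thesis unfolding admissible_iff
  proof (intro conjI)
    show "abs_continuous_on a T (\<lambda>s. heis_shift x d (\<eta> s))"
    proof (rule abs_continuous_on_compose_Lipschitz[of a T \<eta> _ K])
      show "abs_continuous_on a T \<eta>" using adm by (simp add: admissible_iff)
      show "norm (heis_shift x d (\<eta> s) - heis_shift x d (\<eta> r)) \<le> K * norm (\<eta> s - \<eta> r)" for r s
        using K[of "\<eta> s - \<eta> r"] by (simp add: shift linear_diff[OF \<open>linear A\<close>] mult.commute)
    qed
    show "square_integrable_on a T \<beta>" using adm by (simp add: admissible_iff)
    show "heis_shift x d (\<eta> a) = x + d"
      using adm by (simp add: admissible_iff heis_shift_def vec_eq_iff forall_3)
    have "AE s in lebesgue_on {a..T}. (\<eta> has_vector_derivative hvel (\<eta> s) (\<beta> s)) (at s within {a..T})"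
      using adm by (simp add: admissible_iff)
    then show "AE s in lebesgue_on {a..T}. ((\<lambda>s. heis_shift x d (\<eta> s)) has_vector_derivative
         hvel (heis_shift x d (\<eta> s)) (\<beta> s)) (at s within {a..T})"
    proof eventually_elim
      case (elim s)
      have "((\<lambda>s. A (\<eta> s)) has_vector_derivative A (hvel (\<eta> s) (\<beta> s))) (at s within {a..T})"
        by (rule bounded_linear.has_vector_derivative[OF A elim])
      then show ?case unfolding hv shift
        by (rule has_vector_derivative_add_const[THEN iffD2])
    qed
  qed
qed

section \<open>Regularity of the value function\<close>

lemma C2_norm_pointwise:
  assumes "C2_norm \<phi> \<le> ennreal M" "M \<ge> 0"
  shows "\<bar>\<phi> x\<bar> \<le> M" "norm (grad \<phi> x) \<le> M"
proof -
  have "ennreal (\<bar>\<phi> x\<bar> + norm (grad \<phi> x) + norm (hess \<phi> x)) \<le> ennreal M"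
    using assms(1) unfolding C2_norm_def by (meson SUP_upper UNIV_I order_trans)
  then have "\<bar>\<phi> x\<bar> + norm (grad \<phi> x) + norm (hess \<phi> x) \<le> M"
    using assms(2) by (simp add: ennreal_le_iff del: ennreal_plus)
  then show "\<bar>\<phi> x\<bar> \<le> M" "norm (grad \<phi> x) \<le> M"
    using norm_ge_zero[of "grad \<phi> x"] norm_ge_zero[of "hess \<phi> x"] by linarith+
qed

lemma frechet_derivative_eq_grad:
  assumes "\<phi> differentiable (at x)"
  shows "frechet_derivative \<phi> (at x) v = grad \<phi> x \<bullet> v"
proof -
  have lin: "linear (frechet_derivative \<phi> (at x))"
    using assms by (rule linear_frechet_derivative)
  have "frechet_derivative \<phi> (at x) v = frechet_derivative \<phi> (at x) (\<Sum>i\<in>UNIV. v $ i *\<^sub>R axis i 1)"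
    by (simp add: basis_expansion flip: scalar_mult_eq_scaleR)
  also have "\<dots> = (\<Sum>i\<in>UNIV. v $ i * frechet_derivative \<phi> (at x) (axis i 1))"
    using lin by (simp add: linear_sum linear_scale)
  finally show ?thesis by (simp add: grad_def inner_vec_def mult.commute)
qed

lemma C2_fun_Lipschitz:
  assumes "C2_fun \<phi>" "C2_norm \<phi> \<le> ennreal M" "M \<ge> 0"
  shows "\<bar>\<phi> y - \<phi> z\<bar> \<le> M * norm (y - z)"
proof -
  have diff: "\<phi> differentiable (at x)" for x using assms(1) by (simp add: C2_fun_def)
  have "norm (\<phi> y - \<phi> z) \<le> M * norm (y - z)"
  proof (rule differentiable_bound[of UNIV \<phi> "\<lambda>x. frechet_derivative \<phi> (at x)"])
    fix x
    show "(\<phi> has_derivative frechet_derivative \<phi> (at x)) (at x within UNIV)"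
      using diff[of x] by (simp add: frechet_derivative_works)
    show "onorm (frechet_derivative \<phi> (at x)) \<le> M"
    proof (rule onorm_bound[OF \<open>M \<ge> 0\<close>])
      fix v
      have "\<bar>grad \<phi> x \<bullet> v\<bar> \<le> norm (grad \<phi> x) * norm v" by (rule Cauchy_Schwarz_ineq2)
      also have "\<dots> \<le> M * norm v" using C2_norm_pointwise[OF assms(2,3)] by (intro mult_right_mono) auto
      finally show "norm (frechet_derivative \<phi> (at x) v) \<le> M * norm v"
        using frechet_derivative_eq_grad[OF diff] by simp
    qed
  qed auto
  then show ?thesis by simp
qed

text \<open>The C2 norm dominates the sup norm, so continuity in time is uniform in space. The
  uniformity permits use along trajectories that are chosen only later.\<close>

lemma C0_C2_uniform_in_time:
  assumes "C0_C2 T f" "s \<in> {0..T}" "e > 0"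
  shows "\<exists>d>0. \<forall>r\<in>{0..T}. \<bar>r - s\<bar> < d \<longrightarrow> (\<forall>y. \<bar>f y r - f y s\<bar> \<le> e)"
proof -
  have "((\<lambda>r. C2_norm (\<lambda>x. f x r - f x s)) \<longlongrightarrow> 0) (at s within {0..T})"
    using assms by (simp add: C0_C2_def)
  then have "eventually (\<lambda>r. C2_norm (\<lambda>x. f x r - f x s) < ennreal e) (at s within {0..T})"
    using assms(3) by (intro order_tendstoD(2)) auto
  then obtain d where d: "d > 0"
    "\<And>r. r \<in> {0..T} \<Longrightarrow> r \<noteq> s \<Longrightarrow> dist r s < d \<Longrightarrow> C2_norm (\<lambda>x. f x r - f x s) < ennreal e"
    unfolding eventually_at by blast
  have "\<bar>f y r - f y s\<bar> \<le> e" if "r \<in> {0..T}" "\<bar>r - s\<bar> < d" for r y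
  proof (cases "r = s")
    case False
    then have "C2_norm (\<lambda>x. f x r - f x s) \<le> ennreal e"
      using d(2)[of r] that by (simp add: dist_real_def less_imp_le)
    from C2_norm_pointwise(1)[OF this] show ?thesis using assms(3) by simp
  qed (use assms(3) in simp)
  then show ?thesis using d(1) by blast
qed

text \<open>From \<open>4 * A * B \<le> (A + B)\<^sup>2\<close> and
  \<open>1 \<le> (1 - 2*\<delta>) * (1 + 4*\<delta>)\<close>, the latter because
  \<open>\<delta> \<le> 1/4\<close>. Compared with the sharp inequality, a portion
  \<open>\<delta> * N\<close> of the energy is saved.\<close>

lemma young_slack:
  fixes q P h N \<delta> :: real
  assumes "q\<^sup>2 \<le> h * N" "0 \<le> N" "0 < h" "0 \<le> \<delta>" "\<delta> \<le> 1/4"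
  shows "P * q \<le> (1 - 2*\<delta>) * N / 2 + P\<^sup>2 * h * (1 + 4*\<delta>) / 2"
proof (rule power2_le_imp_le)
  let ?A = "(1 - 2*\<delta>) * N / 2" and ?B = "P\<^sup>2 * h * (1 + 4*\<delta>) / 2"
  show "0 \<le> ?A + ?B" using assms by simp
  have "(P * q)\<^sup>2 \<le> P\<^sup>2 * (h * N)" using assms(1) by (simp add: power_mult_distrib mult_left_mono)
  also have "\<dots> \<le> (P\<^sup>2 * (h * N)) * ((1 - 2*\<delta>) * (1 + 4*\<delta>))"
  proof -
    have "\<delta> * (2 - 8 * \<delta>) \<ge> 0" using assms by simp
    then have "1 \<le> (1 - 2*\<delta>) * (1 + 4*\<delta>)" by (simp add: algebra_simps)
    from mult_left_mono[OF this, of "P\<^sup>2 * (h * N)"] show ?thesis using assms by simp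
  qed
  also have "\<dots> = 4 * ?A * ?B" by (simp add: field_simps)
  also have "\<dots> \<le> (?A + ?B)\<^sup>2" using zero_le_power2[of "?A - ?B"] by (simp only: power2_sum power2_diff)
  finally show "(P * q)\<^sup>2 \<le> (?A + ?B)\<^sup>2" .
qed

section \<open>The value function for bounded Lipschitz data\<close>

locale bounded_control_problem =
  fixes T M :: real and f :: "real^3 \<Rightarrow> real \<Rightarrow> real" and g :: "real^3 \<Rightarrow> real"
  assumes T_pos: "T > 0" and M_nonneg: "M \<ge> 0"
    and f_bound: "s \<in> {0..T} \<Longrightarrow> \<bar>f y s\<bar> \<le> M"
    and g_bound: "\<bar>g y\<bar> \<le> M"
    and f_Lipschitz: "s \<in> {0..T} \<Longrightarrow> \<bar>f y s - f z s\<bar> \<le> M * norm (y - z)"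
    and g_Lipschitz: "\<bar>g y - g z\<bar> \<le> M * norm (y - z)"
    and f_time: "s \<in> {0..T} \<Longrightarrow> e > 0 \<Longrightarrow> \<exists>d>0. \<forall>r\<in>{0..T}. \<bar>r - s\<bar> < d \<longrightarrow> (\<forall>y. \<bar>f y r - f y s\<bar> \<le> e)"
begin

abbreviation u :: "real^3 \<Rightarrow> real \<Rightarrow> real" where "u \<equiv> value_function T f g"

text \<open>A bound for the energy of every control that is optimal up to an error of at most \<open>1\<close>.\<close>

definition energy_bound :: real where "energy_bound = 4 * M * (T + 1) + 2"

text \<open>The factor \<open>M * (T + 1)\<close> accounts for running and terminal cost. The other
  one bounds how much a left translation amplifies the initial distance along a trajectory of energy
  at most \<open>energy_bound\<close>.\<close>

definition value_lip :: real where "value_lip = M * (T + 1) * (1 + sqrt (T * energy_bound))"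

lemma energy_bound_pos: "energy_bound > 0" using M_nonneg T_pos by (simp add: energy_bound_def add_nonneg_pos)

lemma value_lip_nonneg: "value_lip \<ge> 0" using M_nonneg T_pos energy_bound_pos by (simp add: value_lip_def)

lemma continuous_on_running_cost:
  assumes \<eta>: "continuous_on {a..b} \<eta>" and "0 \<le> a" "b \<le> T"
  shows "continuous_on {a..b} (\<lambda>s. f (\<eta> s) s)"
  unfolding continuous_on_iff
proof (intro ballI allI impI)
  fix s e :: real assume s: "s \<in> {a..b}" and e: "e > 0"
  have s': "s \<in> {0..T}" using s assms by auto
  obtain d1 where d1: "d1 > 0" "\<And>r y. r \<in> {0..T} \<Longrightarrow> \<bar>r - s\<bar> < d1 \<Longrightarrow> \<bar>f y r - f y s\<bar> \<le> e/2"
    using f_time[OF s', of "e/2"] e by auto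
  have "e / (2 * (M + 1)) > 0" using e M_nonneg by simp
  then obtain d2 where d2: "d2 > 0"
    "\<And>r. r \<in> {a..b} \<Longrightarrow> dist r s < d2 \<Longrightarrow> dist (\<eta> r) (\<eta> s) < e / (2 * (M + 1))"
    using \<eta> s unfolding continuous_on_iff by blast
  have "dist (f (\<eta> r) r) (f (\<eta> s) s) < e" if r: "r \<in> {a..b}" "dist r s < min d1 d2" for r
  proof -
    have "\<bar>f (\<eta> r) r - f (\<eta> r) s\<bar> \<le> e/2" using d1(2)[of r "\<eta> r"] r assms by (auto simp: dist_real_def)
    moreover have "\<bar>f (\<eta> r) s - f (\<eta> s) s\<bar> < e/2"
    proof -
      have "\<bar>f (\<eta> r) s - f (\<eta> s) s\<bar> \<le> M * norm (\<eta> r - \<eta> s)" by (rule f_Lipschitz[OF s'])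
      also have "\<dots> \<le> (M + 1) * norm (\<eta> r - \<eta> s)" by (simp add: mult_right_mono)
      also have "\<dots> < (M + 1) * (e / (2 * (M + 1)))"
        using d2(2)[of r] r M_nonneg by (intro mult_strict_left_mono) (auto simp: dist_norm)
      also have "\<dots> = e/2" using M_nonneg by (simp add: field_simps add_nonneg_eq_0_iff)
      finally show ?thesis .
    qed
    ultimately show ?thesis unfolding dist_real_def by linarith
  qed
  then show "\<exists>d>0. \<forall>r\<in>{a..b}. dist r s < d \<longrightarrow> dist (f (\<eta> r) r) (f (\<eta> s) s) < e"
    using d1(1) d2(1) by (intro exI[of _ "min d1 d2"]) auto
qed

lemma running_cost_absolutely_integrable:
  assumes "(\<eta>, \<beta>) \<in> admissible T x a" "0 \<le> a" "a \<le> c" "d \<le> T"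
  shows "(\<lambda>s. f (\<eta> s) s) absolutely_integrable_on {c..d}"
proof -
  have "continuous_on {a..T} \<eta>"
    using assms(1) by (auto simp: admissible_iff intro: abs_continuous_on_imp_continuous_on)
  then have "continuous_on {c..d} \<eta>" by (rule continuous_on_subset) (use assms in auto)
  then show ?thesis
    using assms by (intro absolutely_integrable_continuous_real continuous_on_running_cost) auto
qed

lemma running_cost_integrable:
  assumes "(\<eta>, \<beta>) \<in> admissible T x a" "0 \<le> a" "a \<le> c" "d \<le> T"
  shows "(\<lambda>s. f (\<eta> s) s) integrable_on {c..d}"
  using running_cost_absolutely_integrable[OF assms] by (simp add: absolutely_integrable_on_def)

lemma cost_eq:
  assumes adm: "(\<eta>, \<beta>) \<in> admissible T x a" and "0 \<le> a"
  shows "cost T f g a \<eta> \<beta> = energy \<beta> a T / 2 + integral {a..T} (\<lambda>s. f (\<eta> s) s) + g (\<eta> T)"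
proof -
  have int: "integrable (lebesgue_on {a..T}) (\<lambda>s. 1/2 * (norm (\<beta> s))\<^sup>2)"
     "integrable (lebesgue_on {a..T}) (\<lambda>s. f (\<eta> s) s)"
    using energy_absolutely_integrable[OF adm order_refl order_refl]
      running_cost_absolutely_integrable[OF adm \<open>0 \<le> a\<close> order_refl order_refl]
    by (auto simp flip: integrable_lebesgue_on_iff)
  have "(LINT s|lebesgue_on {a..T}. 1/2 * (norm (\<beta> s))\<^sup>2 + f (\<eta> s) s)
      = (LINT s|lebesgue_on {a..T}. 1/2 * (norm (\<beta> s))\<^sup>2) + (LINT s|lebesgue_on {a..T}. f (\<eta> s) s)"
    by (rule Bochner_Integration.integral_add[OF int])
  also have "\<dots> = integral {a..T} (\<lambda>s. 1/2 * (norm (\<beta> s))\<^sup>2) + integral {a..T} (\<lambda>s. f (\<eta> s) s)"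
    using lebesgue_integral_eq_integral[OF int(1)] lebesgue_integral_eq_integral[OF int(2)]
    by simp
  finally show ?thesis
    using integral_mult_right[of "{a..T}" "1/2" "\<lambda>s. (norm (\<beta> s))\<^sup>2"]
    by (simp add: cost_def energy_def)
qed

lemma cost_split:
  assumes adm: "(\<eta>, \<beta>) \<in> admissible T x a" and "0 \<le> a" "a \<le> b" "b \<le> T"
  shows "cost T f g a \<eta> \<beta> = energy \<beta> a b / 2 + integral {a..b} (\<lambda>s. f (\<eta> s) s) + cost T f g b \<eta> \<beta>"
proof -
  have "cost T f g b \<eta> \<beta> = energy \<beta> b T / 2 + integral {b..T} (\<lambda>s. f (\<eta> s) s) + g (\<eta> T)"
    using admissible_restrict[OF adm] assms by (intro cost_eq) auto
  moreover have "integral {a..b} (\<lambda>s. f (\<eta> s) s) + integral {b..T} (\<lambda>s. f (\<eta> s) s) = integral {a..T} (\<lambda>s. f (\<eta> s) s)"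
    using assms by (intro Henstock_Kurzweil_Integration.integral_combine running_cost_integrable[OF adm]) auto
  ultimately show ?thesis
    using cost_eq[OF adm \<open>0 \<le> a\<close>] energy_combine[OF adm \<open>a \<le> b\<close> \<open>b \<le> T\<close>] by linarith
qed

lemma abs_integral_running_cost_le:
  assumes adm: "(\<eta>, \<beta>) \<in> admissible T x a" and "0 \<le> a" "a \<le> T"
  shows "\<bar>integral {a..T} (\<lambda>s. f (\<eta> s) s)\<bar> \<le> M * T"
proof -
  have "norm (integral {a..T} (\<lambda>s. f (\<eta> s) s)) \<le> M * (T - a)"
    using assms f_bound M_nonneg by (intro integral_bound abs_continuous_on_imp_continuous_on
        continuous_on_running_cost) (auto simp: admissible_iff)
  also have "\<dots> \<le> M * T" using M_nonneg \<open>0 \<le> a\<close> by (intro mult_left_mono) auto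
  finally show ?thesis by simp
qed

text \<open>Coercivity: it bounds the costs from below, and conversely the energy in terms of the
  cost.\<close>

lemma cost_ge:
  assumes adm: "(\<eta>, \<beta>) \<in> admissible T x a" and "0 \<le> a" "a \<le> T"
  shows "energy \<beta> a T / 2 - M * (T + 1) \<le> cost T f g a \<eta> \<beta>"
  using cost_eq[OF adm \<open>0 \<le> a\<close>] abs_integral_running_cost_le[OF assms] g_bound[of "\<eta> T"]
  unfolding distrib_left mult_1_right by linarith

lemma bdd_below_costs:
  assumes "0 \<le> a" "a \<le> T"
  shows "bdd_below ((\<lambda>(\<eta>, \<beta>). cost T f g a \<eta> \<beta>) ` admissible T x a)"
proof (rule bdd_belowI2)
  fix c assume c: "c \<in> admissible T x a"
  obtain \<eta> \<beta> where eq: "c = (\<eta>, \<beta>)" by (cases c)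
  have "energy \<beta> a T / 2 - M * (T + 1) \<le> cost T f g a \<eta> \<beta>"
    using c assms by (intro cost_ge) (simp_all add: eq)
  then show "- M * (T + 1) \<le> (case c of (\<eta>, \<beta>) \<Rightarrow> cost T f g a \<eta> \<beta>)"
    using energy_nonneg[of \<beta> a T] by (simp add: eq)
qed

lemma value_le_cost:
  assumes "(\<eta>, \<beta>) \<in> admissible T x a" "0 \<le> a" "a \<le> T"
  shows "u x a \<le> cost T f g a \<eta> \<beta>"
  unfolding value_function_def using cINF_lower[OF bdd_below_costs[OF assms(2,3)] assms(1)] by simp

lemma near_optimal:
  assumes "0 \<le> a" "a \<le> T" "e > 0"
  obtains \<eta> \<beta> where "(\<eta>, \<beta>) \<in> admissible T x a" "cost T f g a \<eta> \<beta> < u x a + e"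
proof -
  let ?X = "(\<lambda>(\<eta>, \<beta>). cost T f g a \<eta> \<beta>) ` admissible T x a"
  have "?X \<noteq> {}" using admissible_const[OF assms(2), of x] by blast
  moreover have "Inf ?X < u x a + e" using assms(3) by (simp add: value_function_def)
  ultimately obtain c where "c \<in> ?X" "c < u x a + e" by (metis cInf_lessD)
  then show ?thesis using that by auto
qed

lemma value_le_bound:
  assumes "0 \<le> a" "a \<le> T"
  shows "u x a \<le> M * (T + 1)"
proof -
  note adm = admissible_const[OF assms(2), of x]
  have "u x a \<le> cost T f g a (\<lambda>_. x) (\<lambda>_. 0)" by (rule value_le_cost[OF adm assms])
  also have "\<dots> \<le> M * (T + 1)"
    using cost_eq[OF adm assms(1)] abs_integral_running_cost_le[OF adm assms] g_bound[of x]
    unfolding distrib_left mult_1_right by (simp add: energy_def)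
  finally show ?thesis .
qed

text \<open>Coercivity and the upper bound for \<open>u\<close> give
  \<open>energy \<beta> a T / 2 \<le> 2 * M * (T + 1) + 1\<close>, which explains the constant
  \<open>energy_bound\<close>.\<close>

lemma near_optimal_energy_le:
  assumes "(\<eta>, \<beta>) \<in> admissible T x a" "0 \<le> a" "a \<le> T" "cost T f g a \<eta> \<beta> < u x a + e" "e \<le> 1"
  shows "energy \<beta> a T \<le> energy_bound"
proof -
  define C where "C = M * (T + 1)"
  have "energy \<beta> a T / 2 - C \<le> cost T f g a \<eta> \<beta>" unfolding C_def by (rule cost_ge[OF assms(1-3)])
  moreover have "u x a \<le> C" unfolding C_def by (rule value_le_bound[OF assms(2,3)])
  moreover have "energy_bound = 4 * C + 2" by (simp add: energy_bound_def C_def)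
  ultimately show ?thesis using assms(4,5) by linarith
qed

text \<open>A nearly optimal trajectory from \<open>x\<close> is carried to \<open>y\<close> by a
  left translation, with the same control. The energy does not change and the two curves stay within
  distance \<open>D\<close>, so only the Lipschitz bounds of \<open>f\<close> and \<open>g\<close>
  enter.\<close>

lemma value_Lipschitz_le:
  assumes "0 \<le> a" "a \<le> T"
  shows "u y a \<le> u x a + value_lip * norm (y - x)"
proof (rule field_le_epsilon)
  fix e0 :: real assume "e0 > 0"
  \<comment> \<open>The cap 1 makes \<open>energy_bound\<close> applicable.\<close>
  define e where "e = min 1 e0"
  have e: "e > 0" "e \<le> 1" "e \<le> e0" using \<open>e0 > 0\<close> by (auto simp: e_def)
  obtain \<eta> \<beta> where adm: "(\<eta>, \<beta>) \<in> admissible T x a" and c: "cost T f g a \<eta> \<beta> < u x a + e"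
    using near_optimal[OF assms e(1)] .
  have E: "energy \<beta> a T \<le> energy_bound" by (rule near_optimal_energy_le[OF adm assms c e(2)])
  define \<eta>' where "\<eta>' = (\<lambda>s. heis_shift x (y - x) (\<eta> s))"
  have adm': "(\<eta>', \<beta>) \<in> admissible T y a"
    using admissible_heis_shift[OF adm, of "y - x"] by (simp add: \<eta>'_def)
  define D where "D = norm (y - x) * (1 + sqrt (T * energy_bound))"
  have D: "norm (\<eta>' s - \<eta> s) \<le> D" if s: "s \<in> {a..T}" for s
  proof -
    have "(norm (hpart (\<eta> s - x)))\<^sup>2 \<le> (s - a) * energy \<beta> a s"
      using s by (intro admissible_hpart_bound[OF adm]) auto
    also have "\<dots> \<le> T * energy_bound"
      using s assms E energy_mono[OF adm, of s T] energy_nonneg by (intro mult_mono) auto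
    finally have "norm (hpart (\<eta> s - x)) \<le> sqrt (T * energy_bound)" by (rule real_le_rsqrt)
    then show ?thesis
      unfolding D_def \<eta>'_def by (intro order_trans[OF norm_heis_shift_diff_le] mult_left_mono) auto
  qed
  have "integral {a..T} (\<lambda>s. f (\<eta>' s) s) \<le> integral {a..T} (\<lambda>s. M * D + 1 * f (\<eta> s) s)"
  proof (rule integral_le)
    show "(\<lambda>s. f (\<eta>' s) s) integrable_on {a..T}"
      using running_cost_integrable[OF adm'] assms by simp
    show "(\<lambda>s. M * D + 1 * f (\<eta> s) s) integrable_on {a..T}"
      using running_cost_integrable[OF adm] assms by (intro integrable_add) auto
    fix s assume s: "s \<in> {a..T}"
    have "\<bar>f (\<eta>' s) s - f (\<eta> s) s\<bar> \<le> M * norm (\<eta>' s - \<eta> s)" using s assms by (intro f_Lipschitz) auto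
    also have "\<dots> \<le> M * D" using D[OF s] M_nonneg by (rule mult_left_mono)
    finally show "f (\<eta>' s) s \<le> M * D + 1 * f (\<eta> s) s" by (simp add: abs_le_iff)
  qed
  also have "\<dots> = (T - a) * (M * D) + integral {a..T} (\<lambda>s. f (\<eta> s) s)"
    using integral_affine[OF running_cost_integrable[OF adm], of a T "M * D" 1] assms by simp
  also have "(T - a) * (M * D) \<le> T * (M * D)"
    using assms M_nonneg energy_bound_pos T_pos by (intro mult_right_mono) (auto simp: D_def)
  finally have I: "integral {a..T} (\<lambda>s. f (\<eta>' s) s) \<le> T * (M * D) + integral {a..T} (\<lambda>s. f (\<eta> s) s)"
    by simp
  have "\<bar>g (\<eta>' T) - g (\<eta> T)\<bar> \<le> M * norm (\<eta>' T - \<eta> T)" by (rule g_Lipschitz)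
  also have "\<dots> \<le> M * D" using D[of T] assms M_nonneg by (intro mult_left_mono) auto
  finally have G: "g (\<eta>' T) \<le> g (\<eta> T) + M * D" by (simp add: abs_le_iff)
  have "u y a \<le> cost T f g a \<eta>' \<beta>" by (rule value_le_cost[OF adm' assms])
  also have "\<dots> \<le> cost T f g a \<eta> \<beta> + (T * (M * D) + M * D)"
    using I G cost_eq[OF adm assms(1)] cost_eq[OF adm' assms(1)] by linarith
  also have "T * (M * D) + M * D = value_lip * norm (y - x)" by (simp add: D_def value_lip_def algebra_simps)
  finally show "u y a \<le> u x a + value_lip * norm (y - x) + e0" using c e(3) by simp
qed

lemma value_at_T: "u x T \<ge> g x"
proof (rule field_le_epsilon)
  fix e :: real assume "e > 0"
  then obtain \<eta> \<beta> where adm: "(\<eta>, \<beta>) \<in> admissible T x T" and c: "cost T f g T \<eta> \<beta> < u x T + e"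
    using near_optimal[of T e x] T_pos by auto
  have "cost T f g T \<eta> \<beta> = g x"
    using cost_eq[OF adm] T_pos adm by (simp add: energy_def admissible_iff)
  then show "g x \<le> u x T + e" using c by simp
qed

text \<open>One half of dynamic programming: a nearly optimal trajectory is cut at time
  \<open>b\<close>, where \<open>z\<close> is its position and \<open>N\<close> its energy so far.
  The number \<open>m\<close> bounds \<open>f\<close> from below on a ball that the trajectory
  cannot leave before \<open>b\<close>, so the conclusion no longer mentions the trajectory.\<close>

lemma value_step:
  assumes ab: "0 \<le> a" "a < b" "b \<le> T" and e: "0 < e" "e \<le> 1"
    and m: "\<And>r y. r \<in> {a..b} \<Longrightarrow> norm (y - x) \<le> (1 + norm x + sqrt (T * energy_bound)) * sqrt ((b - a) * energy_bound) \<Longrightarrow> m \<le> f y r"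
  obtains z N where "0 \<le> N" "N \<le> energy_bound" "(norm (hpart (z - x)))\<^sup>2 \<le> (b - a) * N"
    "\<bar>contact x (z - x)\<bar> \<le> (b - a) * N" "N / 2 + (b - a) * m + u z b \<le> u x a + e"
proof -
  have aT: "a \<le> T" using ab by simp
  obtain \<eta> \<beta> where adm: "(\<eta>, \<beta>) \<in> admissible T x a" and c: "cost T f g a \<eta> \<beta> < u x a + e"
    using near_optimal[OF ab(1) aT e(1)] .
  have E: "energy \<beta> a T \<le> energy_bound" by (rule near_optimal_energy_le[OF adm ab(1) aT c e(2)])
  have path: "norm (\<eta> r - x) \<le> (1 + norm x + sqrt (T * energy_bound)) * sqrt ((b - a) * energy_bound)" if r: "r \<in> {a..b}" for r
  proof -
    let ?S = "sqrt ((b - a) * energy_bound)"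
    have le: "(r - a) * energy \<beta> a r \<le> (b - a) * energy_bound"
      using r ab E energy_mono[OF adm, of r T] energy_nonneg by (intro mult_mono) auto
    have "(norm (hpart (\<eta> r - x)))\<^sup>2 \<le> (b - a) * energy_bound"
      using admissible_hpart_bound[OF adm, of r] r ab le by simp
    then have "norm (hpart (\<eta> r - x)) \<le> ?S" by (rule real_le_rsqrt)
    then have "(1 + norm x) * norm (hpart (\<eta> r - x)) \<le> (1 + norm x) * ?S"
      by (intro mult_left_mono) auto
    \<comment> \<open>The vertical bound is \<open>?S * ?S\<close>; one factor is enlarged by
      \<open>b - a \<le> T\<close>, which leaves the common factor \<open>?S\<close>.\<close>
    moreover have "\<bar>contact x (\<eta> r - x)\<bar> \<le> sqrt (T * energy_bound) * ?S"
    proof -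
      have "\<bar>contact x (\<eta> r - x)\<bar> \<le> (b - a) * energy_bound"
        using admissible_contact_bound[OF adm, of r] r ab le by simp
      also have "\<dots> = ?S * ?S" using ab energy_bound_pos by simp
      also have "\<dots> \<le> sqrt (T * energy_bound) * ?S"
        using ab energy_bound_pos by (intro mult_right_mono real_sqrt_le_mono) auto
      finally show ?thesis .
    qed
    ultimately show ?thesis using norm_le_hpart_contact[of "\<eta> r - x" x] by (simp add: algebra_simps)
  qed
  have "(b - a) * m = integral {a..b} (\<lambda>_. m)" using ab by simp
  also have "\<dots> \<le> integral {a..b} (\<lambda>s. f (\<eta> s) s)"
    using m path ab by (intro integral_le running_cost_integrable[OF adm]) auto
  finally have I: "(b - a) * m \<le> integral {a..b} (\<lambda>s. f (\<eta> s) s)" .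
  show thesis
  proof (rule that)
    show "0 \<le> energy \<beta> a b" by (rule energy_nonneg)
    show "energy \<beta> a b \<le> energy_bound" using E energy_mono[OF adm, of b T] ab by simp
    show "(norm (hpart (\<eta> b - x)))\<^sup>2 \<le> (b - a) * energy \<beta> a b"
      using ab by (intro admissible_hpart_bound[OF adm]) auto
    show "\<bar>contact x (\<eta> b - x)\<bar> \<le> (b - a) * energy \<beta> a b"
      using ab by (intro admissible_contact_bound[OF adm]) auto
    have "u (\<eta> b) b \<le> cost T f g b \<eta> \<beta>"
      using admissible_restrict[OF adm, of b] ab by (intro value_le_cost) auto
    then show "energy \<beta> a b / 2 + (b - a) * m + u (\<eta> b) b \<le> u x a + e"
      using I c cost_split[OF adm, of b] ab by linarith
  qed
qed

text \<open>The end point \<open>z\<close> of a nearly optimal trajectory lies within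
  \<open>K * sqrt (h * N)\<close> of \<open>x\<close>. Replacing \<open>z\<close> by
  \<open>x\<close> costs a Lipschitz error, which the energy term \<open>N / 2\<close> absorbs by
  completing a square. The rate is uniform on the ball of radius \<open>R\<close>, hence along a
  compact curve.\<close>

lemma value_time_le:
  assumes ab: "0 \<le> a" "a \<le> b" "b \<le> T" and R: "norm x \<le> R"
  shows "u x b - u x a \<le> (M + (value_lip * (1 + R + sqrt (T * energy_bound)))\<^sup>2 / 2) * (b - a)"
proof (cases "a = b")
  case False
  define K where "K = 1 + R + sqrt (T * energy_bound)"
  define h where "h = b - a"
  have h: "0 < h" "h \<le> T" using False ab by (auto simp: h_def)
  have "u x b \<le> u x a + h * (M + (value_lip * K)\<^sup>2 / 2) + e0" if "e0 > 0" for e0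
  proof -
    define e where "e = min 1 e0"
    have e: "e > 0" "e \<le> 1" "e \<le> e0" using \<open>e0 > 0\<close> by (auto simp: e_def)
    have m: "- M \<le> f y r" if "r \<in> {a..b}" "norm (y - x) \<le> (1 + norm x + sqrt (T * energy_bound)) * sqrt ((b - a) * energy_bound)" for r y
      using f_bound[of r y] that ab by (simp add: abs_le_iff)
    obtain z N where z: "0 \<le> N" "N \<le> energy_bound" "(norm (hpart (z - x)))\<^sup>2 \<le> h * N"
      "\<bar>contact x (z - x)\<bar> \<le> h * N" "N / 2 + h * (- M) + u z b \<le> u x a + e"
      unfolding h_def
    proof (rule value_step[OF ab(1) _ ab(3) e(1,2) m])
      show "a < b" using False ab(2) by simp
    qed blast+
    let ?S = "sqrt (h * N)"
    have "norm (hpart (z - x)) \<le> ?S" using z(3) by (rule real_le_rsqrt)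
    then have "(1 + norm x) * norm (hpart (z - x)) \<le> (1 + R) * ?S"
      using R norm_ge_zero[of x] by (intro mult_mono norm_ge_zero) linarith+
    moreover have "\<bar>contact x (z - x)\<bar> \<le> sqrt (T * energy_bound) * ?S"
    proof -
      have "h * N \<le> T * energy_bound" using h z(1,2) energy_bound_pos by (intro mult_mono) linarith+
      then have "?S \<le> sqrt (T * energy_bound)" by (rule real_sqrt_le_mono)
      then have "?S * ?S \<le> sqrt (T * energy_bound) * ?S"
        by (rule mult_right_mono) (use h(1) z(1) in simp)
      moreover have "?S * ?S = h * N" using h(1) z(1) by simp
      ultimately show ?thesis using z(4) by linarith
    qed
    ultimately have "norm (z - x) \<le> K * ?S"
      using norm_le_hpart_contact[of "z - x" x] by (simp add: K_def algebra_simps)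
    then have "value_lip * norm (x - z) \<le> value_lip * (K * ?S)"
      using value_lip_nonneg by (simp add: mult_left_mono norm_minus_commute)
    moreover have "value_lip * (K * ?S) \<le> N / 2 + h * ((value_lip * K)\<^sup>2 / 2)"
    proof -
      have "0 \<le> (sqrt N - value_lip * K * sqrt h)\<^sup>2" by simp
      also have "\<dots> = N + (value_lip * K)\<^sup>2 * h - 2 * (value_lip * (K * ?S))"
        using h z(1) by (simp add: power2_diff power_mult_distrib real_sqrt_mult)
      finally have "2 * (value_lip * (K * ?S)) \<le> N + (value_lip * K)\<^sup>2 * h" by simp
      moreover have "h * ((value_lip * K)\<^sup>2 / 2) = (value_lip * K)\<^sup>2 * h / 2" by simp
      ultimately show ?thesis by linarith
    qed
    moreover have "u x b \<le> u z b + value_lip * norm (x - z)"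
      using value_Lipschitz_le[of b x z] ab by simp
    moreover have "N / 2 - h * M + u z b \<le> u x a + e" using z(5) by simp
    ultimately have "u x b \<le> u x a + e + (h * M + h * ((value_lip * K)\<^sup>2 / 2))"
      by linarith
    then show ?thesis using e(3) unfolding distrib_left by linarith
  qed
  then have "u x b \<le> u x a + h * (M + (value_lip * K)\<^sup>2 / 2)" by (rule field_le_epsilon)
  then show ?thesis by (simp add: K_def h_def algebra_simps)
qed simp

end

section \<open>The left-sided estimate along the curve\<close>

context bounded_control_problem
begin

text \<open>The estimate goes backwards in time, since \<open>u(\<cdot>,s)\<close> is only known to be differentiable at the
  later of the two times. The slack \<open>\<delta>\<close> in Young's inequality absorbs the errors proportional to the
  energy \<open>N\<close>, which is bounded but not known to be \<open>O(h)\<close>.\<close>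

lemma value_left_estimate:
  assumes t: "0 \<le> t" and s: "t < s" "s \<le> T"
    and H: "has_H_derivative (\<lambda>y. u y s) p (\<xi> s)"
    and \<xi>: "(\<xi> has_vector_derivative hvel (\<xi> s) (- p)) (at s within {t..T})"
    and e: "e > 0"
  shows "\<exists>d>0. \<forall>r\<in>{t..<s}. s - r < d \<longrightarrow>
    u (\<xi> s) s - u (\<xi> r) r \<le> (s - r) * (- ((norm p)\<^sup>2 / 2 + f (\<xi> s) s) + e)"
proof -
  define y where "y = \<xi> s"
  define P where "P = norm p"
  define C where "C = norm (hvel y p)"
  \<comment> \<open>Here \<open>C + 1\<close> stems from the change of base point of the contact
    form, \<open>1 + norm y\<close> from the contact form of the remainder \<open>E\<close>.\<close>
  define C1 where "C1 = C + 2 + norm y"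
  \<comment> \<open>Bounds the sum of all coefficients of \<open>\<delta> * h\<close> in the final
    estimate; the multiples of \<open>\<delta> * N\<close> cancel there.\<close>
  define C2 where "C2 = 5 + 2 * P + 2 * P\<^sup>2 + value_lip * C1"
  have nn: "P \<ge> 0" "C \<ge> 0" "C1 \<ge> 0" by (simp_all add: P_def C_def C1_def)
  have C2: "C2 > 0" using nn value_lip_nonneg by (simp add: C2_def add_pos_nonneg)
  define \<delta> where "\<delta> = min (1/4) (e / C2)"
  have \<delta>: "0 < \<delta>" "\<delta> \<le> 1/4" "\<delta> * C2 \<le> e" using e C2 by (auto simp: \<delta>_def min_def field_simps)
  obtain d1 where d1: "d1 > 0" "\<And>r. r \<in> {t..T} \<Longrightarrow> \<bar>r - s\<bar> < d1 \<Longrightarrow>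
      norm (\<xi> r - \<xi> s - (r - s) *\<^sub>R hvel (\<xi> s) (- p)) \<le> \<delta> * \<bar>r - s\<bar>"
    using has_vector_derivative_withinD[OF \<xi> \<delta>(1)] by blast
  obtain \<rho> where \<rho>: "\<rho> > 0" "\<And>k. norm k < \<rho> \<Longrightarrow>
      \<bar>u (\<xi> s + hvel (\<xi> s) k) s - u (\<xi> s) s - p \<bullet> k\<bar> \<le> \<delta> * norm k"
    using has_H_derivativeD[OF H \<delta>(1)] by blast
  obtain d2 where d2: "d2 > 0" "\<And>r y. r \<in> {0..T} \<Longrightarrow> \<bar>r - s\<bar> < d2 \<Longrightarrow> \<bar>f y r - f y s\<bar> \<le> \<delta>"
    using f_time[of s \<delta>] \<delta>(1) s t by auto
  let ?\<sigma> = "\<lambda>h. sqrt (h * energy_bound)"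
  have lim: "((\<lambda>h. h) \<longlongrightarrow> (0::real)) (at_right 0)" "(?\<sigma> \<longlongrightarrow> 0) (at_right 0)"
     "((\<lambda>h. h * P + \<delta> * h + ?\<sigma> h) \<longlongrightarrow> 0) (at_right 0)"
     "((\<lambda>h. h * (C + 1)) \<longlongrightarrow> 0) (at_right 0)"
     "((\<lambda>h. 2 * value_lip * h) \<longlongrightarrow> 0) (at_right 0)"
     "((\<lambda>h. M * ((2 + norm y + sqrt (T * energy_bound)) * ?\<sigma> h + h * (C + 1))) \<longlongrightarrow> 0) (at_right 0)"
    by (auto intro!: tendsto_eq_intros)
  \<comment> \<open>The conditions involve the uniform \<open>energy_bound\<close> but not the
    trajectory chosen later, so one \<open>d\<close> serves all \<open>r\<close>.\<close>
  have "eventually (\<lambda>h. h < min d1 d2 \<and> ?\<sigma> h < \<delta> \<and> h * P + \<delta> * h + ?\<sigma> h < \<rho> \<and> h * (C + 1) < 1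
      \<and> 2 * value_lip * h < \<delta> \<and> M * ((2 + norm y + sqrt (T * energy_bound)) * ?\<sigma> h + h * (C + 1)) < \<delta>) (at_right 0)"
    using lim \<delta>(1) \<rho>(1) d1(1) d2(1) by (intro eventually_conj order_tendstoD(2)[of _ 0]) auto
  then obtain d where d: "d > 0" and small: "\<And>h. 0 < h \<Longrightarrow> h < d \<Longrightarrow>
      h < min d1 d2 \<and> ?\<sigma> h < \<delta> \<and> h * P + \<delta> * h + ?\<sigma> h < \<rho> \<and> h * (C + 1) < 1
      \<and> 2 * value_lip * h < \<delta> \<and> M * ((2 + norm y + sqrt (T * energy_bound)) * ?\<sigma> h + h * (C + 1)) < \<delta>"
    unfolding eventually_at_right_field by blast
  have "u (\<xi> s) s - u (\<xi> r) r \<le> (s - r) * (- ((norm p)\<^sup>2 / 2 + f (\<xi> s) s) + e)"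
    if r: "r \<in> {t..<s}" "s - r < d" for r
  proof -
    define h where "h = s - r"
    define x where "x = \<xi> r"
    have h: "0 < h" "h < d" using r by (auto simp: h_def)
    note sm = small[OF h]
    \<comment> \<open>The curve has control \<open>- p\<close> and is followed backwards, hence the
      displacement \<open>h *\<^sub>R hvel y p\<close> with a positive sign.\<close>
    define E where "E = x - y - h *\<^sub>R hvel y p"
    have E: "norm E \<le> \<delta> * h"
    proof -
      have "E = \<xi> r - \<xi> s - (r - s) *\<^sub>R hvel (\<xi> s) (- p)"
        by (simp add: E_def x_def y_def h_def hvel_minus algebra_simps)
      then show ?thesis using d1(2)[of r] r sm s by (auto simp: h_def)
    qed
    have xy: "x - y = h *\<^sub>R hvel y p + E" by (simp add: E_def)
    have nxy: "norm (x - y) \<le> h * (C + 1)"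
    proof -
      have "norm (x - y) \<le> h * C + \<delta> * h"
        unfolding xy using E h by (intro order_trans[OF norm_triangle_ineq]) (simp add: C_def)
      also have "\<delta> * h \<le> h" using \<delta> h by simp
      finally show ?thesis by (simp add: algebra_simps)
    qed
    have nx: "norm x \<le> norm y + 1"
      using norm_triangle_ineq2[of x y] nxy sm by linarith
    define m where "m = f y s - 2 * \<delta>"
    have m: "m \<le> f v q" if q: "q \<in> {r..s}"
      and v: "norm (v - x) \<le> (1 + norm x + sqrt (T * energy_bound)) * sqrt ((s - r) * energy_bound)" for q v
    proof -
      have "\<bar>f v q - f v s\<bar> \<le> \<delta>" using d2(2)[of q v] q sm r t s by (auto simp: h_def)
      moreover have "\<bar>f v s - f y s\<bar> \<le> M * norm (v - y)" using t s by (intro f_Lipschitz) auto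
      moreover have "M * norm (v - y) \<le> M * ((2 + norm y + sqrt (T * energy_bound)) * ?\<sigma> h + h * (C + 1))"
      proof (rule mult_left_mono[OF _ M_nonneg])
        have "norm (v - y) \<le> norm (v - x) + norm (x - y)"
          using norm_triangle_ineq[of "v - x" "x - y"] by simp
        moreover have "(1 + norm x + sqrt (T * energy_bound)) * ?\<sigma> h \<le> (2 + norm y + sqrt (T * energy_bound)) * ?\<sigma> h"
          using nx h energy_bound_pos by (intro mult_right_mono) auto
        ultimately show "norm (v - y) \<le> (2 + norm y + sqrt (T * energy_bound)) * ?\<sigma> h + h * (C + 1)"
          using v nxy unfolding h_def by linarith
      qed
      ultimately show ?thesis using sm unfolding m_def by linarith
    qed
    \<comment> \<open>The tolerance is proportional to \<open>h\<close>, to be negligible at first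
      order, and at most 1, as the energy bound demands.\<close>
    have r4: "0 \<le> r" "r < s" "0 < min 1 ((s - r) * \<delta>)" "min 1 ((s - r) * \<delta>) \<le> 1"
      using r t \<delta> by auto
    obtain z N where z: "0 \<le> N" "N \<le> energy_bound" "(norm (hpart (z - x)))\<^sup>2 \<le> h * N"
      "\<bar>contact x (z - x)\<bar> \<le> h * N" "N / 2 + h * m + u z s \<le> u x r + min 1 (h * \<delta>)"
      unfolding h_def by (rule value_step[OF r4(1,2) s(2) r4(3,4) m]) blast+
    define \<Delta> where "\<Delta> = hpart (z - x)"
    define q where "q = norm \<Delta>"
    have q0: "q \<ge> 0" by (simp add: q_def)
    have q2: "q\<^sup>2 \<le> h * N" using z(3) by (simp add: q_def \<Delta>_def)
    have "h * N \<le> h * energy_bound" using z(2) h(1) by simp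
    then have q\<sigma>: "q \<le> ?\<sigma> h" using q2 by (intro real_le_rsqrt) simp
    \<comment> \<open>Replaces \<open>sqrt (h * N)\<close>, which is not comparable to
      \<open>h\<close>, by terms that the slack in \<open>h\<close> and in \<open>N\<close> can
      absorb.\<close>
    have qAM: "q \<le> (h + N) / 2"
    proof (rule power2_le_imp_le)
      have "h * N \<le> ((h + N) / 2)\<^sup>2"
        using zero_le_power2[of "h - N"] by (simp add: power2_eq_square field_simps)
      then show "q\<^sup>2 \<le> ((h + N) / 2)\<^sup>2" using q2 by simp
    qed (use h z(1) in simp)
    \<comment> \<open>The point \<open>y + hvel y k\<close> has the horizontal coordinates of
      \<open>z\<close> and is reached from \<open>y\<close> by a horizontal increment, so the
      derivative at \<open>y\<close> applies to it.\<close>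
    define k where "k = hpart (z - y)"
    have zy: "z - y = (z - x) + (h *\<^sub>R hvel y p + E)" using xy by (simp add: algebra_simps)
    have k: "k = h *\<^sub>R p + hpart E + \<Delta>"
      unfolding k_def zy \<Delta>_def by (simp add: hpart_add hpart_scaleR)
    have hE: "norm (hpart E) \<le> \<delta> * h" using norm_hpart_le[of E] E by simp
    have nk: "norm k \<le> h * P + \<delta> * h + q"
    proof -
      have "norm k \<le> norm (h *\<^sub>R p) + norm (hpart E) + norm \<Delta>"
        unfolding k by (meson norm_triangle_ineq norm_triangle_le add_right_mono order_trans)
      then show ?thesis using hE h(1) by (simp add: P_def q_def)
    qed
    have "norm (z - (y + hvel y k)) \<le> h * N + \<delta> * h * C1"
    proof -
      have "norm (z - (y + hvel y k)) \<le> \<bar>contact y (z - y)\<bar>"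
      proof -
        have "hpart (z - y - hvel y k) = 0" by (simp add: hpart_diff k_def)
        moreover have "contact y (z - y - hvel y k) = contact y (z - y)"
          by (simp add: contact_def algebra_simps)
        ultimately show ?thesis
          using norm_le_hpart_contact[of "z - y - hvel y k" y] by (simp add: diff_diff_eq)
      qed
      also have "contact y (z - y) = contact y (z - x) + contact y E"
        unfolding zy by (simp add: contact_add contact_scaleR)
      \<comment> \<open>Moving the base point to \<open>x\<close> makes the quadratic bound from
        \<open>value_step\<close> available, at the price of a determinant.\<close>
      also have "contact y (z - x) = contact x (z - x) + (hpart (y - x) $ 2 * \<Delta> $ 1 - hpart (y - x) $ 1 * \<Delta> $ 2)"
        by (simp add: contact_def \<Delta>_def algebra_simps)
      finally have "norm (z - (y + hvel y k)) \<le>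
          \<bar>contact x (z - x)\<bar> + \<bar>hpart (y - x) $ 1 * \<Delta> $ 2 - hpart (y - x) $ 2 * \<Delta> $ 1\<bar> + \<bar>contact y E\<bar>"
        by linarith
      also have "\<bar>hpart (y - x) $ 1 * \<Delta> $ 2 - hpart (y - x) $ 2 * \<Delta> $ 1\<bar> \<le> h * (C + 1) * \<delta>"
      proof (rule order_trans[OF abs_det2_le mult_mono])
        show "norm (hpart (y - x)) \<le> h * (C + 1)"
          using norm_hpart_le[of "y - x"] nxy by (simp add: norm_minus_commute)
        show "norm \<Delta> \<le> \<delta>" using q\<sigma> sm by (simp add: q_def)
      qed (use h nn in auto)
      also have "\<bar>contact y E\<bar> \<le> (1 + norm y) * (\<delta> * h)"
        using abs_contact_le[of y E] E by (meson add_nonneg_nonneg mult_left_mono norm_ge_zero order_trans zero_le_one)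
      finally show ?thesis using z(4) by (simp add: C1_def algebra_simps)
    qed
    then have "value_lip * norm (y + hvel y k - z) \<le> value_lip * (h * N + \<delta> * h * C1)"
      using value_lip_nonneg by (simp add: mult_left_mono norm_minus_commute)
    moreover have "u (y + hvel y k) s \<le> u z s + value_lip * norm (y + hvel y k - z)"
      using t s by (intro value_Lipschitz_le) auto
    moreover have "u y s + p \<bullet> k - \<delta> * norm k \<le> u (y + hvel y k) s"
    proof -
      have "norm k < \<rho>" using nk q\<sigma> sm by linarith
      from \<rho>(2)[OF this] show ?thesis by (simp add: y_def abs_le_iff)
    qed
    moreover have "\<delta> * norm k \<le> \<delta> * (h * P + \<delta> * h + (h + N) / 2)"
    proof (rule mult_left_mono)
      show "norm k \<le> h * P + \<delta> * h + (h + N) / 2" using nk qAM by linarith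
    qed (use \<delta>(1) in simp)
    moreover have "h * P\<^sup>2 - P * (\<delta> * h) - P * q \<le> p \<bullet> k"
    proof -
      have "p \<bullet> k = h * P\<^sup>2 + p \<bullet> hpart E + p \<bullet> \<Delta>"
        by (simp add: k inner_add_right P_def power2_norm_eq_inner)
      moreover have "\<bar>p \<bullet> hpart E\<bar> \<le> P * (\<delta> * h)"
        using Cauchy_Schwarz_ineq2[of p "hpart E"] mult_left_mono[OF hE, of P] nn by (simp add: P_def)
      moreover have "\<bar>p \<bullet> \<Delta>\<bar> \<le> P * q"
        using Cauchy_Schwarz_ineq2[of p \<Delta>] by (simp add: P_def q_def)
      ultimately show ?thesis by linarith
    qed
    moreover have "P * q \<le> (1 - 2*\<delta>) * N / 2 + P\<^sup>2 * h * (1 + 4*\<delta>) / 2"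
      using q2 z(1) h(1) \<delta> by (intro young_slack) auto
    \<comment> \<open>This share and the equal one from \<open>\<delta> * norm k\<close> use up
      exactly the energy \<open>\<delta> * N\<close> saved by \<open>young_slack\<close>.\<close>
    moreover have "value_lip * (h * N) \<le> \<delta> * N / 2"
      using mult_right_mono[of "2 * value_lip * h" \<delta> N] sm z(1) by simp
    moreover have "N / 2 + h * m + u z s \<le> u x r + h * \<delta>" using z(5) by linarith
    moreover have "\<delta> * (\<delta> * h) \<le> \<delta> * h" using \<delta> h by (intro mult_left_mono) auto
    moreover have "h * (\<delta> * C2) \<le> h * e" using \<delta>(3) h(1) by simp
    ultimately have "u y s - u x r \<le> - (h * (P\<^sup>2 / 2 + f y s)) + h * e"
      unfolding m_def C2_def using mult_pos_pos[OF \<delta>(1) h(1)] 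
      by (simp only: algebra_simps add_divide_distrib diff_divide_distrib times_divide_eq_right)
    then show ?thesis by (simp add: h_def y_def x_def P_def algebra_simps)
  qed
  then show ?thesis using d by blast
qed

end

text \<open>Almost everywhere the control is the horizontal part of the derivative of
  \<open>\<xi>\<close>, hence a limit of continuous difference quotients. The feedback control is
  defined point by point and gets its measurability only in this way.\<close>

lemma horizontal_control_measurable:
  assumes \<xi>: "continuous_on {t..T} \<xi>"
    and der: "AE s in lebesgue_on {t..T}. (\<xi> has_vector_derivative hvel (\<xi> s) (\<alpha> s)) (at s within {t..T})"
  shows "\<alpha> \<in> borel_measurable (lebesgue_on {t..T})"
proof -
  obtain N where N: "negligible N"
    "\<And>s. s \<in> {t..T} - N \<Longrightarrow> (\<xi> has_vector_derivative hvel (\<xi> s) (\<alpha> s)) (at s within {t..T})"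
    using AE_lebesgue_on_negligibleE[OF der] by auto
  have lin: "linear hpart" by (rule linearI) (simp_all add: hpart_add hpart_scaleR)
  \<comment> \<open>Forward quotients, cut off at \<open>T\<close> to stay in the domain. For
    \<open>s < T\<close> the cut-off is inactive once \<open>n\<close> is large; \<open>T\<close>
    itself joins the exceptional set.\<close>
  define F where "F n s = real (Suc n) *\<^sub>R hpart (\<xi> (min (s + 1 / real (Suc n)) T) - \<xi> s)" for n s
  have "\<alpha> measurable_on {t..T}"
  proof (rule measurable_on_limit)
    fix n
    have shift: "continuous_on {t..T} (\<lambda>s. \<xi> (min (s + 1 / real (Suc n)) T))"
      by (rule continuous_on_compose2[OF \<xi>]) (auto intro!: continuous_intros simp: add_increasing2)
    have "continuous_on {t..T} (F n)"
      unfolding F_def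
      by (intro continuous_on_scaleR continuous_on_const linear_continuous_on_compose[OF _ lin]
          continuous_on_diff shift \<xi>)
    then show "F n measurable_on {t..T}"
      by (simp add: measurable_on_iff_borel_measurable continuous_imp_measurable_on_sets_lebesgue)
  next
    show "negligible (N \<union> {T})" using N(1) by (simp add: negligible_Un)
  next
    fix s assume s: "s \<in> {t..T} - (N \<union> {T})"
    let ?v = "hvel (\<xi> s) (\<alpha> s)"
    show "(\<lambda>n. F n s) \<longlonglongrightarrow> \<alpha> s"
    proof (rule LIMSEQ_I)
      fix e :: real assume "e > 0"
      then obtain d where d: "d > 0" "\<And>r. r \<in> {t..T} \<Longrightarrow> \<bar>r - s\<bar> < d \<Longrightarrow>
          norm (\<xi> r - \<xi> s - (r - s) *\<^sub>R ?v) \<le> e/2 * \<bar>r - s\<bar>"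
        using has_vector_derivative_withinD[OF N(2)[of s], of "e/2"] s by auto
      have "min d (T - s) > 0" using d(1) s by auto
      then obtain n0 where n0: "1 / real (Suc n0) < min d (T - s)"
        using reals_Archimedean by (metis inverse_eq_divide)
      have "norm (F n s - \<alpha> s) < e" if "n \<ge> n0" for n
      proof -
        define h where "h = 1 / real (Suc n)"
        have "h \<le> 1 / real (Suc n0)" using that by (simp add: h_def frac_le)
        then have h: "0 < h" "h < d" "s + h < T" "real (Suc n) * h = 1" using n0 by (auto simp: h_def)
        have "norm (\<xi> (s + h) - \<xi> s - h *\<^sub>R ?v) \<le> e/2 * h"
          using d(2)[of "s + h"] h s by auto
        then have *: "norm (hpart (\<xi> (s + h) - \<xi> s - h *\<^sub>R ?v)) \<le> e/2 * h"
          using norm_hpart_le order_trans by blast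
        have "F n s - \<alpha> s = real (Suc n) *\<^sub>R hpart (\<xi> (s + h) - \<xi> s - h *\<^sub>R ?v)"
        proof -
          have "min (s + 1 / real (Suc n)) T = s + h"
            using h(3) unfolding h_def by (rule min_absorb1[OF less_imp_le])
          then have "F n s = real (Suc n) *\<^sub>R hpart (\<xi> (s + h) - \<xi> s)"
            unfolding F_def by (simp only:)
          moreover have "real (Suc n) *\<^sub>R hpart (h *\<^sub>R ?v) = \<alpha> s"
            using h(4) by (simp only: hpart_scaleR hpart_hvel scaleR_scaleR scaleR_one)
          ultimately show ?thesis by (simp only: hpart_diff[of "\<xi> (s + h) - \<xi> s"] scaleR_diff_right)
        qed
        then have "norm (F n s - \<alpha> s) = real (Suc n) * norm (hpart (\<xi> (s + h) - \<xi> s - h *\<^sub>R ?v))"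
          by simp
        also have "\<dots> \<le> real (Suc n) * (e/2 * h)" using * by (intro mult_left_mono) auto
        also have "\<dots> = e/2" using h(4) by (metis mult.assoc mult.commute mult.right_neutral)
        finally show ?thesis using \<open>e > 0\<close> by linarith
      qed
      then show "\<exists>no. \<forall>n\<ge>no. norm (F n s - \<alpha> s) < e" by blast
    qed
  qed
  then show ?thesis by (simp add: measurable_on_iff_borel_measurable)
qed

text \<open>Integrating the left-sided estimate and using
  \<open>g (\<xi> T) \<le> u (\<xi> T) T\<close> shows that the cost is at most
  \<open>u x t\<close>. The opposite inequality holds once the feedback control is known to be
  admissible.\<close>

lemma (in bounded_control_problem) optimal_feedback:
  assumes t: "0 < t" "t < T" and ac: "abs_continuous_on t T \<xi>" and x: "\<xi> t = x"
    and \<alpha>: "\<alpha> = (\<lambda>s. - D_H (\<lambda>y. u y s) (\<xi> s))"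
    and der: "AE s in lebesgue_on {t..T}. H_differentiable (\<lambda>y. u y s) (\<xi> s) \<and>
      (\<xi> has_vector_derivative hvel (\<xi> s) (\<alpha> s)) (at s within {t..T})"
  shows "optimal_control T f g x t \<alpha>"
proof -
  have cont: "continuous_on {t..T} \<xi>" using ac by (rule abs_continuous_on_imp_continuous_on)
  have der': "AE s in lebesgue_on {t..T}. (\<xi> has_vector_derivative hvel (\<xi> s) (\<alpha> s)) (at s within {t..T})"
    using der by eventually_elim simp
  obtain R where R: "R > 0" "\<And>s. s \<in> {t..T} \<Longrightarrow> norm (\<xi> s) \<le> R"
    using compact_imp_bounded[OF compact_continuous_image[OF cont compact_Icc]]
    unfolding bounded_pos by blast
  obtain N where "negligible N" and good: "\<And>s. s \<in> {t..T} - N \<Longrightarrow>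
      H_differentiable (\<lambda>y. u y s) (\<xi> s) \<and> (\<xi> has_vector_derivative hvel (\<xi> s) (\<alpha> s)) (at s within {t..T})"
    using AE_lebesgue_on_negligibleE[OF der] by auto
  then have N: "negligible N"
    "\<And>s. s \<in> {t..T} - N \<Longrightarrow> has_H_derivative (\<lambda>y. u y s) (- \<alpha> s) (\<xi> s)"
    "\<And>s. s \<in> {t..T} - N \<Longrightarrow> (\<xi> has_vector_derivative hvel (\<xi> s) (\<alpha> s)) (at s within {t..T})"
    using H_differentiable_D_H by (auto simp: \<alpha>)
  have meas: "\<alpha> \<in> borel_measurable (lebesgue_on {t..T})"
    using horizontal_control_measurable[OF cont der'] .
  \<comment> \<open>Lipschitz continuity of \<open>u\<close> bounds its horizontal derivative; the
    control is thus essentially bounded and in particular square integrable.\<close>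
  have bound: "norm (\<alpha> s) \<le> value_lip * (1 + R)" if s: "s \<in> {t..T} - N" for s
  proof -
    have "u (\<xi> s + hvel (\<xi> s) h) s - u (\<xi> s) s \<le> 0 \<bullet> h + value_lip * (1 + R) * norm h" for h
    proof -
      have "u (\<xi> s + hvel (\<xi> s) h) s - u (\<xi> s) s \<le> value_lip * norm (hvel (\<xi> s) h)"
        using value_Lipschitz_le[of s "\<xi> s + hvel (\<xi> s) h" "\<xi> s"] s t by simp
      also have "\<dots> \<le> value_lip * ((1 + R) * norm h)"
        using R(2)[of s] s value_lip_nonneg
        by (intro mult_left_mono order_trans[OF norm_hvel_le] mult_right_mono) auto
      finally show ?thesis by (simp add: mult.assoc)
    qed
    from has_H_derivative_le[OF N(2)[OF s] this] show ?thesis by simp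
  qed
  have sq: "integrable (lebesgue_on {t..T}) (\<lambda>s. (norm (\<alpha> s))\<^sup>2)"
  proof (rule Bochner_Integration.integrable_bound)
    show "integrable (lebesgue_on {t..T}) (\<lambda>_. (value_lip * (1 + R))\<^sup>2)"
      by (simp add: integrable_lebesgue_on_iff absolutely_integrable_on_const)
    show "(\<lambda>s. (norm (\<alpha> s))\<^sup>2) \<in> borel_measurable (lebesgue_on {t..T})" using meas by measurable
    show "AE s in lebesgue_on {t..T}. norm ((norm (\<alpha> s))\<^sup>2) \<le> norm ((value_lip * (1 + R))\<^sup>2)"
      by (rule AE_lebesgue_on_negligibleI[OF N(1)]) (use bound in \<open>auto intro!: power_mono\<close>)
  qed
  have adm: "(\<xi>, \<alpha>) \<in> admissible T x t"
    using ac meas sq x der' by (simp add: admissible_iff square_integrable_on_def)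
  let ?\<gamma> = "\<lambda>s. - (1/2 * (norm (\<alpha> s))\<^sup>2 + f (\<xi> s) s)"
  have \<gamma>_neg: "(\<lambda>s. 1/2 * (norm (\<alpha> s))\<^sup>2 + f (\<xi> s) s) absolutely_integrable_on {t..T}"
    using energy_absolutely_integrable[OF adm order_refl order_refl]
      running_cost_absolutely_integrable[OF adm _ order_refl order_refl] t
    by (intro set_integral_add(1) set_integrable_mult_right) auto
  have "(\<lambda>s. - 1 * (1/2 * (norm (\<alpha> s))\<^sup>2 + f (\<xi> s) s)) absolutely_integrable_on {t..T}"
    by (rule set_integrable_mult_right[OF \<gamma>_neg])
  then have \<gamma>: "?\<gamma> absolutely_integrable_on {t..T}" by (simp only: mult_minus1)
  define Ct where "Ct = M + (value_lip * (1 + R + sqrt (T * energy_bound)))\<^sup>2 / 2"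
  have Ct: "Ct \<ge> 0" using M_nonneg by (simp add: Ct_def)
  have "upper_abs_continuous t T (\<lambda>s. u (\<xi> s) s)"
  proof (rule upper_abs_continuousI[OF ac])
    show "value_lip + Ct \<ge> 0" using value_lip_nonneg Ct by simp
    fix r s assume rs: "r \<in> {t..T}" "s \<in> {t..T}" "r \<le> s"
    \<comment> \<open>The increment splits into a move in space at the later time and a step in time
      at the fixed point \<open>\<xi> r\<close>.\<close>
    have "u (\<xi> s) s \<le> u (\<xi> r) s + value_lip * norm (\<xi> s - \<xi> r)"
      using rs t by (intro value_Lipschitz_le) auto
    moreover have "u (\<xi> r) s - u (\<xi> r) r \<le> Ct * (s - r)"
      unfolding Ct_def using rs t R(2) by (intro value_time_le) auto
    moreover have "0 \<le> Ct * norm (\<xi> s - \<xi> r)" "0 \<le> value_lip * (s - r)" using Ct value_lip_nonneg rs by auto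
    ultimately show "u (\<xi> s) s - u (\<xi> r) r \<le> (value_lip + Ct) * (norm (\<xi> s - \<xi> r) + (s - r))"
      unfolding distrib_left distrib_right by linarith
  qed
  then have "u (\<xi> T) T - u (\<xi> t) t \<le> integral {t..T} ?\<gamma>"
  proof (rule upper_abs_continuous_increment_le[OF less_imp_le[OF t(2)] _ \<gamma> N(1)])
    fix s e :: real assume s: "s \<in> {t<..T} - N" and e: "e > 0"
    then show "\<exists>d>0. \<forall>r\<in>{t..<s}. s - r < d \<longrightarrow> u (\<xi> s) s - u (\<xi> r) r \<le> (s - r) * (?\<gamma> s + e)"
      using value_left_estimate[of t s "- \<alpha> s" \<xi> e] N(2,3)[of s] t by simp
  qed
  moreover have "integral {t..T} ?\<gamma> = g (\<xi> T) - cost T f g t \<xi> \<alpha>"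
  proof -
    have "integrable (lebesgue_on {t..T}) (\<lambda>s. 1/2 * (norm (\<alpha> s))\<^sup>2 + f (\<xi> s) s)"
      using \<gamma>_neg by (simp add: integrable_lebesgue_on_iff)
    then have "cost T f g t \<xi> \<alpha> = integral {t..T} (\<lambda>s. 1/2 * (norm (\<alpha> s))\<^sup>2 + f (\<xi> s) s) + g (\<xi> T)"
      unfolding cost_def by (subst lebesgue_integral_eq_integral) auto
    then show ?thesis by (simp only: integral_neg)
  qed
  ultimately have "cost T f g t \<xi> \<alpha> \<le> u x t"
    using value_at_T[of "\<xi> T"] x by simp
  moreover have "u x t \<le> cost T f g t \<xi> \<alpha>" using adm t by (intro value_le_cost) auto
  ultimately show ?thesis using adm unfolding optimal_control_def by force
qed

theorem lemma4p5:
  fixes T t :: real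
    and f :: "real^3 \<Rightarrow> real \<Rightarrow> real"
    and g :: "real^3 \<Rightarrow> real"
    and u :: "real^3 \<Rightarrow> real \<Rightarrow> real"
    and x :: "real^3"
    and \<xi> :: "real \<Rightarrow> real^3"
  assumes "T > 0"
    and "C0_C2 T f"
    and "C2_fun g"
    and "\<forall>s\<in>{0..T}. heis_periodic (\<lambda>y. f y s)"
    and "heis_periodic g"
    and "(SUP s\<in>{0..T}. C2_norm (\<lambda>y. f y s)) + C2_norm g < \<infinity>"
    and "u = value_function T f g"
    and "0 < t" and "t < T"
    and "abs_continuous_on t T \<xi>"
    and "\<xi> t = x"
    and "AE s in lebesgue_on {t..T}.
           H_differentiable (\<lambda>y. u y s) (\<xi> s) \<and>
           (\<xi> has_vector_derivative
              (- D_H (\<lambda>y. u y s) (\<xi> s)) v* transpose (Bmat (\<xi> s))) (at s within {t..T})"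
  shows "optimal_control T f g x t (\<lambda>s. - D_H (\<lambda>y. u y s) (\<xi> s))"
proof -
  define S where "S = (SUP s\<in>{0..T}. C2_norm (\<lambda>y. f y s)) + C2_norm g"
  \<comment> \<open>Finiteness of the norms makes \<open>S\<close> a real number, which bounds the
    data uniformly in time.\<close>
  define M where "M = enn2real S"
  have M: "ennreal M = S" "M \<ge> 0"
    using assms(6) by (simp_all add: M_def S_def infinity_ennreal_def)
  have fM: "C2_norm (\<lambda>y. f y s) \<le> ennreal M" if "s \<in> {0..T}" for s
  proof -
    have "C2_norm (\<lambda>y. f y s) \<le> (SUP s\<in>{0..T}. C2_norm (\<lambda>y. f y s))" using that by (rule SUP_upper)
    also have "\<dots> \<le> S" by (simp add: S_def)
    finally show ?thesis by (simp add: M)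
  qed
  have gM: "C2_norm g \<le> ennreal M" by (simp add: M S_def)
  interpret bounded_control_problem T M f g
  proof
    show "T > 0" "M \<ge> 0" by fact+
    show "\<bar>g y\<bar> \<le> M" for y by (rule C2_norm_pointwise(1)[OF gM M(2)])
    show "\<bar>g y - g z\<bar> \<le> M * norm (y - z)" for y z by (rule C2_fun_Lipschitz[OF assms(3) gM M(2)])
    fix s assume s: "s \<in> {0..T}"
    show "\<bar>f y s\<bar> \<le> M" for y by (rule C2_norm_pointwise(1)[OF fM[OF s] M(2)])
    have "C2_fun (\<lambda>y. f y s)" using assms(2) s by (simp add: C0_C2_def)
    then show "\<bar>f y s - f z s\<bar> \<le> M * norm (y - z)" for y z by (rule C2_fun_Lipschitz[OF _ fM[OF s] M(2)])
    show "\<exists>d>0. \<forall>r\<in>{0..T}. \<bar>r - s\<bar> < d \<longrightarrow> (\<forall>y. \<bar>f y r - f y s\<bar> \<le> e)" if "e > 0" for e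
      by (rule C0_C2_uniform_in_time[OF assms(2) s that])
  qed
  have B: "q v* transpose (Bmat v) = hvel v q" for q v
    unfolding row_times_transpose_Bmat hvel_def ..
  show ?thesis
    using assms(12) unfolding assms(7) B by (rule optimal_feedback[OF assms(8-11) refl])
qed

end
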